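(* The following is a complete list of the two-dimensional real Lie subalgebras of $\mathfrak{su}(2,1)$ up to conjugation in $\mathrm{SU}(2,1)$: (1) $\mathfrak{v}_{2,1}=\langle A_3+A_4-A_7+A_8,\;A_1+A_2+A_6\rangle$; (2) $\mathfrak{v}_{2,2}=\langle A_1+2A_2-A_4+\sqrt2A_6-\sqrt2A_8,\;A_1+2A_2+3A_4\rangle$; (3) $\mathfrak{v}_{2,3}=\langle A_1,\;A_2\rangle$; (4) $\mathfrak{v}_{2,4}=\langle A_5-A_7,\;A_1+2A_2+3A_4\rangle$; (5) $\mathfrak{v}_{2,5}=\langle A_3+A_4-A_7+A_8,\;A_5\rangle$; (6) $\mathfrak{v}_{2,6}^\lambda=\langle A_1+2A_2-A_4+\sqrt2A_6-\sqrt2A_8,\;2\lambda A_1+4\lambda A_2+6\lambda A_4-\sqrt2A_5+\sqrt2A_7\rangle$, $\lambda\in\mathbb{R}$, where $\mathfrak{v}_{2,6}^\lambda\sim\mathfrak{v}_{2,6}^\eta$ iff $\eta=\lambda$. That is, every two-dimensional real subalgebra of $\mathfrak{su}(2,1)$ is conjugate under $\mathrm{SU}(2,1)$ to a subalgebra in this list, and distinct entries of the list (including distinct parameter values in (6)) are non-conjugate under $\mathrm{SU}(2,1)$.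
   Context: Let $N=\mathrm{diag}(1,1,-1)$. $\mathfrak{su}(2,1)$ is the real Lie algebra of traceless complex $3\times3$ matrices $x$ with $-N\bar x^{t}N^{-1}=x$, and $\mathrm{SU}(2,1)$ is the group of $g\in\mathrm{SL}_3(\mathbb{C})$ with $N(\bar g^{t})^{-1}N^{-1}=g$. $\mathrm{SU}(2,1)$ acts on subalgebras by $g\cdot\mathfrak{v}=g\mathfrak{v}g^{-1}$; $\mathfrak{u}\sim\mathfrak{v}$ means that $\mathfrak{u}$ and $\mathfrak{v}$ lie in the same orbit. With $E_{ij}$ the matrix units, the real basis of $\mathfrak{su}(2,1)$ used is $A_1=i(E_{11}-E_{22})$, $A_2=i(E_{22}-E_{33})$, $A_3=E_{12}-E_{21}$, $A_4=i(E_{12}+E_{21})$, $A_5=E_{13}+E_{31}$, $A_6=i(E_{13}-E_{31})$, $A_7=E_{23}+E_{32}$, $A_8=i(E_{23}-E_{32})$. $\langle\cdots\rangle$ denotes the real linear span. *)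

theory Defs
  imports "HOL-Analysis.Analysis"
begin

text \<open>
  Throughout, \<open>subspace\<close>, \<open>span\<close> and \<open>dim\<close> on \<open>complex^3^3\<close> are the library's
  notions over the real field. In the index type \<open>3\<close> the third index is \<open>3 = 0\<close>.
\<close>

type_synonym cmat3 = "complex^3^3"

definition conj_transpose :: "cmat3 \<Rightarrow> cmat3" where
  "conj_transpose x = (\<chi> i j. cnj (x $ j $ i))"

definition cscale :: "complex \<Rightarrow> cmat3 \<Rightarrow> cmat3" where
  "cscale c x = (\<chi> i j. c * x $ i $ j)"

definition lie_bracket :: "cmat3 \<Rightarrow> cmat3 \<Rightarrow> cmat3" where
  "lie_bracket x y = x ** y - y ** x"

definition N21 :: cmat3 where
  "N21 = (\<chi> i j. if i = j then (if i = 3 then -1 else 1) else 0)"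

definition su21 :: "cmat3 set" where
  "su21 = {x. trace x = 0 \<and> - (N21 ** conj_transpose x ** matrix_inv N21) = x}"

definition SU21 :: "cmat3 set" where
  "SU21 = {g. det g = 1 \<and> N21 ** matrix_inv (conj_transpose g) ** matrix_inv N21 = g}"

definition lie_subalgebra_su21 :: "cmat3 set \<Rightarrow> bool" where
  "lie_subalgebra_su21 v \<longleftrightarrow>
     v \<subseteq> su21 \<and> subspace v \<and> (\<forall>x\<in>v. \<forall>y\<in>v. lie_bracket x y \<in> v)"

definition SU21_act :: "cmat3 \<Rightarrow> cmat3 set \<Rightarrow> cmat3 set" where
  "SU21_act g v = (\<lambda>x. g ** x ** matrix_inv g) ` v"

definition SU21_conjugate :: "cmat3 set \<Rightarrow> cmat3 set \<Rightarrow> bool" where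
  "SU21_conjugate u v \<longleftrightarrow> (\<exists>g\<in>SU21. SU21_act g u = v)"

definition E :: "3 \<Rightarrow> 3 \<Rightarrow> cmat3" where
  "E k l = (\<chi> i j. if i = k \<and> j = l then 1 else 0)"

definition A1 :: cmat3 where "A1 = cscale \<i> (E 1 1 - E 2 2)"
definition A2 :: cmat3 where "A2 = cscale \<i> (E 2 2 - E 3 3)"
definition A3 :: cmat3 where "A3 = E 1 2 - E 2 1"
definition A4 :: cmat3 where "A4 = cscale \<i> (E 1 2 + E 2 1)"
definition A5 :: cmat3 where "A5 = E 1 3 + E 3 1"
definition A6 :: cmat3 where "A6 = cscale \<i> (E 1 3 - E 3 1)"
definition A7 :: cmat3 where "A7 = E 2 3 + E 3 2"
definition A8 :: cmat3 where "A8 = cscale \<i> (E 2 3 - E 3 2)"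

text \<open>
  The entries of the list are labelled by a datatype, so that \<open>V26 \<mu>\<close> for different
  \<open>\<mu>\<close> count as different entries.
\<close>

datatype entry = V21 | V22 | V23 | V24 | V25 | V26 real

fun entry_algebra :: "entry \<Rightarrow> cmat3 set" where
  "entry_algebra V21 = span {A3 + A4 - A7 + A8, A1 + A2 + A6}"
| "entry_algebra V22 =
     span {A1 + 2 *\<^sub>R A2 - A4 + sqrt 2 *\<^sub>R A6 - sqrt 2 *\<^sub>R A8, A1 + 2 *\<^sub>R A2 + 3 *\<^sub>R A4}"
| "entry_algebra V23 = span {A1, A2}"
| "entry_algebra V24 = span {A5 - A7, A1 + 2 *\<^sub>R A2 + 3 *\<^sub>R A4}"
| "entry_algebra V25 = span {A3 + A4 - A7 + A8, A5}"
| "entry_algebra (V26 \<mu>) =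
     span {A1 + 2 *\<^sub>R A2 - A4 + sqrt 2 *\<^sub>R A6 - sqrt 2 *\<^sub>R A8,
           (2 * \<mu>) *\<^sub>R A1 + (4 * \<mu>) *\<^sub>R A2 + (6 * \<mu>) *\<^sub>R A4 - sqrt 2 *\<^sub>R A5 + sqrt 2 *\<^sub>R A7}"

end

theory Submission
  imports Defs "HOL-Computational_Algebra.Fundamental_Theorem_Algebra"
begin

text \<open>
  A two-dimensional Lie algebra is solvable, so by Lie's theorem it has a common eigenvector in
  \<open>\<complex>\<^sup>3\<close>. If some common eigenvector is isotropic, it extends to a frame with antidiagonal Gram
  matrix in which the algebra is upper triangular, and conjugating by unipotent and diagonal
  matrices brings it to a normal form. Otherwise, passing to orthogonal complements gives an
  orthogonal basis of common eigenvectors, and the algebra is the compact Cartan subalgebra. Two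
  frames with the same Gram matrix differ by an element of \<open>U(2,1)\<close>, which can be rescaled into
  \<open>SU(2,1)\<close>. The normal forms are told apart by commutativity, nilpotency, traces of squares and,
  for \<open>V26\<close>, by the determinant of an element acting as the identity on the derived algebra.
\<close>

section \<open>Matrices of size three and conjugation\<close>

text \<open>The matrix conjugating a given subalgebra to a list entry is never built from
  generators: both are images of one \<open>model e\<close> under frames, and only the Gram matrices
  of the frames are compared. The shape of the list comes from the adjoint action in upper
  triangular coordinates. A torus element with parameters r, s multiplies the Heisenberg coordinate
  by the complex weight r + 3is and the centre by the real weight 2r. A bracket has no torus part,
  so a torus element and a nilpotent direction span a subalgebra only if that direction is an
  eigenvector with real eigenvalue. On the Heisenberg coordinate with r nonzero this forces s = 0,
  and with r = 0 it is impossible unless s = 0. On the centre it is automatic, so the ratio s : r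
  stays free: r = 0 gives \<open>V22\<close>, and all other ratios form the family
  \<open>V26\<close>.\<close>

definition mat3 where
  "mat3 a b c d e f g h i = (vector [vector [a, b, c], vector [d, e, f], vector [g, h, i]] :: cmat3)"

lemma mat3_nth [simp]:
  "mat3 a b c d e f g h i $ 1 $ 1 = a" "mat3 a b c d e f g h i $ 1 $ 2 = b" "mat3 a b c d e f g h i $ 1 $ 3 = c"
  "mat3 a b c d e f g h i $ 2 $ 1 = d" "mat3 a b c d e f g h i $ 2 $ 2 = e" "mat3 a b c d e f g h i $ 2 $ 3 = f"
  "mat3 a b c d e f g h i $ 3 $ 1 = g" "mat3 a b c d e f g h i $ 3 $ 2 = h" "mat3 a b c d e f g h i $ 3 $ 3 = i"
  by (simp_all add: mat3_def)

text \<open>As a rewrite rule this would loop, so it is applied by \<open>subst\<close> at chosen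
  occurrences or used to name the nine entries; the rules for \<open>mat3\<close> then reduce matrix
  identities to scalar ones.\<close>

lemma mat3_expand:
  "x = mat3 (x$1$1) (x$1$2) (x$1$3) (x$2$1) (x$2$2) (x$2$3) (x$3$1) (x$3$2) (x$3$3)"
  by (simp add: vec_eq_iff forall_3)

lemma mat3_eq_iff [simp]:
  "mat3 a b c d e f g h i = mat3 a' b' c' d' e' f' g' h' i' \<longleftrightarrow>
   a = a' \<and> b = b' \<and> c = c' \<and> d = d' \<and> e = e' \<and> f = f' \<and> g = g' \<and> h = h' \<and> i = i'"
  by (auto simp: vec_eq_iff forall_3)

lemma mat3_mult [simp]:
  "mat3 a b c d e f g h i ** mat3 a' b' c' d' e' f' g' h' i' =
   mat3 (a*a'+b*d'+c*g') (a*b'+b*e'+c*h') (a*c'+b*f'+c*i')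
        (d*a'+e*d'+f*g') (d*b'+e*e'+f*h') (d*c'+e*f'+f*i')
        (g*a'+h*d'+i*g') (g*b'+h*e'+i*h') (g*c'+h*f'+i*i')"
  by (simp add: vec_eq_iff forall_3 matrix_matrix_mult_def sum_3)

lemma mat3_linear [simp]:
  "mat3 a b c d e f g h i + mat3 a' b' c' d' e' f' g' h' i' =
   mat3 (a+a') (b+b') (c+c') (d+d') (e+e') (f+f') (g+g') (h+h') (i+i')"
  "mat3 a b c d e f g h i - mat3 a' b' c' d' e' f' g' h' i' =
   mat3 (a-a') (b-b') (c-c') (d-d') (e-e') (f-f') (g-g') (h-h') (i-i')"
  "- mat3 a b c d e f g h i = mat3 (-a) (-b) (-c) (-d) (-e) (-f) (-g) (-h) (-i)"
  "k *\<^sub>R mat3 a b c d e f g h i =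
   mat3 (of_real k*a) (of_real k*b) (of_real k*c) (of_real k*d) (of_real k*e) (of_real k*f)
        (of_real k*g) (of_real k*h) (of_real k*i)"
  "cscale l (mat3 a b c d e f g h i) =
   mat3 (l*a) (l*b) (l*c) (l*d) (l*e) (l*f) (l*g) (l*h) (l*i)"
  unfolding vec_eq_iff forall_3 by (simp_all add: cscale_def) (simp_all add: scaleR_conv_of_real)

lemma mat3_ops [simp]:
  "conj_transpose (mat3 a b c d e f g h i) =
   mat3 (cnj a) (cnj d) (cnj g) (cnj b) (cnj e) (cnj h) (cnj c) (cnj f) (cnj i)"
  "trace (mat3 a b c d e f g h i) = a + e + i"
  "det (mat3 a b c d e f g h i) = a*e*i + b*f*g + c*d*h - a*f*h - b*d*i - c*e*g"
  by (simp_all add: vec_eq_iff forall_3 conj_transpose_def trace_def sum_3 det_3)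

lemma mat3_consts:
  "mat 1 = mat3 1 0 0 0 1 0 0 0 1" "(0::cmat3) = mat3 0 0 0 0 0 0 0 0 0"
  "N21 = mat3 1 0 0 0 1 0 0 0 (-1)"
  "A1 = mat3 \<i> 0 0 0 (-\<i>) 0 0 0 0" "A2 = mat3 0 0 0 0 \<i> 0 0 0 (-\<i>)"
  "A3 = mat3 0 1 0 (-1) 0 0 0 0 0" "A4 = mat3 0 \<i> 0 \<i> 0 0 0 0 0"
  "A5 = mat3 0 0 1 0 0 0 1 0 0" "A6 = mat3 0 0 \<i> 0 0 0 (-\<i>) 0 0"
  "A7 = mat3 0 0 0 0 0 1 0 1 0" "A8 = mat3 0 0 0 0 0 \<i> 0 (-\<i>) 0"
  by (simp_all add: vec_eq_iff forall_3 mat_def N21_def A1_def A2_def A3_def A4_def A5_def A6_def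
      A7_def A8_def cscale_def E_def)

lemma conj_transpose_mult: "conj_transpose (x ** y) = conj_transpose y ** conj_transpose x"
  by (subst (1 2) mat3_expand[of x], subst (1 2) mat3_expand[of y]) simp

lemma cscale_mult:
  "cscale c x ** y = cscale c (x ** y)" "x ** cscale c y = cscale c (x ** y)"
  by (simp_all add: vec_eq_iff cscale_def matrix_matrix_mult_def sum_distrib_left mult_ac)

lemma cscale_simps:
  "cscale a (cscale b x) = cscale (a * b) x" "cscale 1 x = x"
  "conj_transpose (cscale a x) = cscale (cnj a) (conj_transpose x)"
  by (simp_all add: vec_eq_iff cscale_def conj_transpose_def mult_ac)

lemma det_cscale: "det (cscale c x) = c ^ 3 * det x"
  by (subst (1 2) mat3_expand[of x]) (simp add: power3_eq_cube algebra_simps)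

lemma det_conj_transpose: "det (conj_transpose x) = cnj (det x)"
  by (subst (1 2) mat3_expand[of x]) (simp add: algebra_simps)

section \<open>The group SU(2,1), its Lie algebra and the conjugation action\<close>

lemma N21_sq: "N21 ** N21 = mat 1"
  by (simp add: mat3_consts)

lemma matrix_inv_mult:
  fixes g :: "'a::field^'n^'n"
  assumes "invertible g"
  shows "g ** matrix_inv g = mat 1" "matrix_inv g ** g = mat 1"
  using someI_ex[OF assms[unfolded invertible_def]] by (simp_all add: matrix_inv_def)

lemma matrix_inv_eqI:
  fixes a b :: "'a::field^'n^'n"
  assumes "a ** b = mat 1"
  shows "matrix_inv a = b"
proof -
  have "invertible a" using assms invertible_right_inverse by blast
  then have "matrix_inv a ** (a ** b) = b"
    by (simp add: matrix_mul_assoc matrix_inv_mult)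
  then show ?thesis using assms by simp
qed

lemma N21_inv: "matrix_inv N21 = N21"
  by (rule matrix_inv_eqI[OF N21_sq])

lemma matrix_inv_cancel:
  fixes g :: "'a::field^'n^'n"
  assumes "invertible g"
  shows "g ** matrix_inv g = mat 1" "matrix_inv g ** g = mat 1"
    "x ** g ** matrix_inv g = x" "x ** matrix_inv g ** g = x"
    "g ** (matrix_inv g ** x) = x" "matrix_inv g ** (g ** x) = x"
  using matrix_inv_mult[OF assms] by (simp_all add: matrix_mul_assoc[symmetric]) (simp_all add: matrix_mul_assoc)

text \<open>Skew-adjointness for the Hermitian form, free of inverses. In this shape the condition
  carries over to any frame, with \<open>N21\<close> replaced by the Gram matrix.\<close>

lemma su21_iff: "x \<in> su21 \<longleftrightarrow> trace x = 0 \<and> conj_transpose x ** N21 + N21 ** x = 0"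
proof -
  obtain a b c d e f g h i where x: "x = mat3 a b c d e f g h i"
    using mat3_expand by blast
  show ?thesis
    unfolding su21_def N21_inv x by (auto simp: mat3_consts complex_eq_iff)
qed

lemma SU21_I:
  assumes "det g = 1" "conj_transpose g ** N21 ** g = N21"
  shows "g \<in> SU21"
proof -
  have "conj_transpose g ** (N21 ** g ** N21) = mat 1"
    using assms(2) N21_sq by (simp add: matrix_mul_assoc)
  then have "matrix_inv (conj_transpose g) = N21 ** g ** N21" by (rule matrix_inv_eqI)
  then show ?thesis
    using assms(1) by (simp add: SU21_def N21_inv matrix_mul_assoc N21_sq) 
      (simp add: matrix_mul_assoc[symmetric] N21_sq)
qed

lemma SU21_act_act:
  assumes "invertible g" "invertible h"
  shows "SU21_act g (SU21_act h u) = SU21_act (g ** h) u"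
proof -
  have "matrix_inv (g ** h) = matrix_inv h ** matrix_inv g"
    by (rule matrix_inv_eqI) (simp add: matrix_mul_assoc matrix_inv_cancel assms)
  then show ?thesis by (simp add: SU21_act_def image_image matrix_mul_assoc)
qed

lemma SU21_act_one: "SU21_act (mat 1) u = u"
  using matrix_inv_eqI[of "mat 1 :: cmat3" "mat 1"] by (simp add: SU21_act_def)

lemma SU21_act_inverse:
  assumes "invertible g"
  shows "SU21_act g (SU21_act (matrix_inv g) u) = u" "SU21_act (matrix_inv g) (SU21_act g u) = u"
proof -
  have "invertible (matrix_inv g)"
    using matrix_inv_mult[OF assms] by (auto simp: invertible_def)
  then show "SU21_act g (SU21_act (matrix_inv g) u) = u" "SU21_act (matrix_inv g) (SU21_act g u) = u"
    using assms by (simp_all add: SU21_act_act matrix_inv_cancel SU21_act_one)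
qed

lemma invertible_det_complex: "invertible (x::cmat3) \<longleftrightarrow> det x \<noteq> 0"
  by (rule invertible_det_nz)

text \<open>A scalar c changes a determinant of size three by the factor c^3; this supplies the
  phase that normalizes the determinant of an element of U(2,1).\<close>

lemma unit_cube_root:
  assumes "cmod d = 1"
  shows "\<exists>c. cmod c = 1 \<and> c ^ 3 * d = 1"
proof
  let ?c = "cis (- (Arg d / 3))"
  have "d = cis (Arg d)" using assms
    by (metis cis_Arg norm_zero sgn_eq one_neq_zero div_by_1 of_real_1)
  moreover have "?c ^ 3 * cis (Arg d) = 1"
    unfolding Complex.DeMoivre cis_mult by simp
  ultimately show "cmod ?c = 1 \<and> ?c ^ 3 * d = 1" by auto
qed

text \<open>The transition matrix F' F^-1 preserves the form. Multiplying it by a phase puts it into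
  SU(2,1) without changing its action, since scalars conjugate trivially.\<close>

lemma isometric_frames_conjugate:
  assumes "conj_transpose F ** N21 ** F = conj_transpose F' ** N21 ** F'" "invertible F" "invertible F'"
  shows "SU21_conjugate (SU21_act F W) (SU21_act F' W)"
proof -
  define g where "g = F' ** matrix_inv F"
  have gF: "g ** F = F'" by (simp add: g_def matrix_inv_cancel assms)
  have "conj_transpose F ** (conj_transpose g ** N21 ** g) ** F = conj_transpose F ** N21 ** F"
    using assms(1) by (simp add: gF[symmetric] conj_transpose_mult matrix_mul_assoc)
  moreover have "x = y" if "conj_transpose F ** x ** F = conj_transpose F ** y ** F" for x y
  proof -
    have "invertible (conj_transpose F)"
      using assms(2) by (simp add: invertible_det_complex det_conj_transpose)
    then show ?thesis using that assms(2)
      by (metis matrix_inv_cancel(3) matrix_inv_cancel(6))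
  qed
  ultimately have g: "conj_transpose g ** N21 ** g = N21" by blast
  have "det N21 = -1" by (simp add: mat3_consts)
  with arg_cong[OF g, of det] have "cnj (det g) * det g = 1"
    by (simp add: det_mul det_conj_transpose)
  then have "cmod (det g) = 1"
    by (metis abs_norm_cancel cmod_power2 complex_mod_cnj norm_mult norm_one power2_eq_1_iff power2_eq_square
        abs_one abs_minus_cancel)
  then obtain c where c: "cmod c = 1" "c ^ 3 * det g = 1" using unit_cube_root by blast
  have cc: "cnj c * c = 1" "c * cnj c = 1"
    using c(1) by (simp_all add: complex_norm_square[symmetric] mult.commute[of "cnj c"])
  let ?g = "cscale c g"
  have "?g \<in> SU21"
    by (rule SU21_I) (simp_all add: c det_cscale cscale_simps cscale_mult cc g)
  moreover have invg: "invertible g"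
    using \<open>cmod (det g) = 1\<close> by (auto simp: invertible_det_complex)
  have "matrix_inv ?g = cscale (cnj c) (matrix_inv g)"
    by (rule matrix_inv_eqI) (simp add: cscale_mult cscale_simps cc matrix_inv_cancel invg)
  then have "SU21_act ?g u = SU21_act g u" for u
    by (simp add: SU21_act_def cscale_mult cscale_simps cc)
  then have "SU21_act ?g (SU21_act F W) = SU21_act F' W"
    by (simp add: SU21_act_act invg assms gF)
  ultimately show ?thesis unfolding SU21_conjugate_def by blast
qed

section \<open>Planes of matrices and Lie's theorem\<close>

text \<open>Explicit real coefficients make closure under the bracket a pair of numbers p, q that
  can be compared coordinatewise; \<open>span\<close> and \<open>dim\<close> enter only when passing
  to and from the statement of the theorem.\<close>

definition plane_basis :: "cmat3 set \<Rightarrow> cmat3 \<Rightarrow> cmat3 \<Rightarrow> bool" where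
  "plane_basis u x y \<longleftrightarrow>
     (\<forall>p q. p *\<^sub>R x + q *\<^sub>R y = 0 \<longrightarrow> p = 0 \<and> q = 0) \<and> u = {p *\<^sub>R x + q *\<^sub>R y |p q. True}"

lemma plane_basis_mem:
  assumes "plane_basis u x y"
  shows "p *\<^sub>R x + q *\<^sub>R y \<in> u" "x \<in> u" "y \<in> u"
proof -
  have *: "p *\<^sub>R x + q *\<^sub>R y \<in> u" for p q using assms by (auto simp: plane_basis_def)
  show "p *\<^sub>R x + q *\<^sub>R y \<in> u" "x \<in> u" "y \<in> u" using *[of p q] *[of 1 0] *[of 0 1] by auto
qed

lemma plane_basis_swap: "plane_basis u x y \<Longrightarrow> plane_basis u y x"
  unfolding plane_basis_def add.commute[of "_ *\<^sub>R y" "_ *\<^sub>R x"] by blast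

lemma plane_basis_scale:
  assumes "plane_basis u x y" "c \<noteq> 0"
  shows "plane_basis u (c *\<^sub>R x) y"
  unfolding plane_basis_def
proof (intro conjI allI impI)
  fix p q assume "p *\<^sub>R c *\<^sub>R x + q *\<^sub>R y = 0"
  then have "(p * c) *\<^sub>R x + q *\<^sub>R y = 0" by simp
  then have "p * c = 0" "q = 0" using assms unfolding plane_basis_def by blast+
  then show "p = 0" "q = 0" using assms(2) by auto
next
  have "\<exists>p' q'. p *\<^sub>R x + q *\<^sub>R y = p' *\<^sub>R c *\<^sub>R x + q' *\<^sub>R y" for p q
    by (rule exI[of _ "p / c"], rule exI[of _ q]) (simp add: assms)
  moreover have "\<exists>p' q'. p *\<^sub>R c *\<^sub>R x + q *\<^sub>R y = p' *\<^sub>R x + q' *\<^sub>R y" for p q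
    by (rule exI[of _ "p * c"], rule exI[of _ q]) simp
  ultimately show "u = {p *\<^sub>R c *\<^sub>R x + q *\<^sub>R y |p q. True}"
    using assms(1) unfolding plane_basis_def by blast
qed

lemma plane_basis_shear:
  assumes "plane_basis u x y"
  shows "plane_basis u x (y + c *\<^sub>R x)"
  unfolding plane_basis_def
proof (intro conjI allI impI)
  fix p q assume "p *\<^sub>R x + q *\<^sub>R (y + c *\<^sub>R x) = 0"
  then have "(p + q * c) *\<^sub>R x + q *\<^sub>R y = 0" by (simp add: algebra_simps)
  then have "p + q * c = 0" "q = 0" using assms unfolding plane_basis_def by auto
  then show "p = 0" "q = 0" by auto
next
  have "\<exists>p' q'. p *\<^sub>R x + q *\<^sub>R y = p' *\<^sub>R x + q' *\<^sub>R (y + c *\<^sub>R x)" for p q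
    by (rule exI[of _ "p - q * c"], rule exI[of _ q]) (simp add: algebra_simps)
  moreover have "\<exists>p' q'. p *\<^sub>R x + q *\<^sub>R (y + c *\<^sub>R x) = p' *\<^sub>R x + q' *\<^sub>R y" for p q
    by (rule exI[of _ "p + q * c"], rule exI[of _ q]) (simp add: algebra_simps)
  ultimately show "u = {p *\<^sub>R x + q *\<^sub>R (y + c *\<^sub>R x) |p q. True}"
    using assms(1) unfolding plane_basis_def by blast
qed

lemma plane_basis_span:
  assumes "\<And>p q. p *\<^sub>R x + q *\<^sub>R y = 0 \<Longrightarrow> p = 0 \<and> q = 0"
  shows "plane_basis (span {x, y}) x y" "dim (span {x, y}) = 2"
proof -
  show "plane_basis (span {x, y}) x y"
    unfolding plane_basis_def
  proof (intro conjI set_eqI iffI)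
    show "\<forall>p q. p *\<^sub>R x + q *\<^sub>R y = 0 \<longrightarrow> p = 0 \<and> q = 0" using assms by blast
  next
    fix z assume "z \<in> span {x, y}"
    then obtain p q where "z - p *\<^sub>R x = q *\<^sub>R y" by (auto simp: span_insert span_singleton)
    then have "z = p *\<^sub>R x + q *\<^sub>R y" by (simp add: algebra_simps)
    then show "z \<in> {p *\<^sub>R x + q *\<^sub>R y |p q. True}" by blast
  next
    fix z assume "z \<in> {p *\<^sub>R x + q *\<^sub>R y |p q. True}"
    then show "z \<in> span {x, y}" by (auto simp del: insert_iff intro!: span_add span_scale) (simp_all add: span_base)
  qed
  have xy: "x \<noteq> y" using assms[of 1 "-1"] by auto
  have "independent {x, y}"
  proof -
    have "y \<noteq> 0" using assms[of 0 1] by auto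
    moreover have "x \<notin> span {y}"
    proof
      assume "x \<in> span {y}"
      then obtain k where "x = k *\<^sub>R y" by (auto simp: span_singleton)
      then show False using assms[of 1 "-k"] by simp
    qed
    ultimately show ?thesis using xy by (simp add: independent_insert)
  qed
  then show "dim (span {x, y}) = 2" using xy dim_eq_card_independent by fastforce
qed

lemma plane_basis_exists:
  assumes "subspace u" "dim u = 2"
  shows "\<exists>x y. plane_basis u x y"
proof -
  obtain B where B: "B \<subseteq> u" "independent B" "u \<subseteq> span B" "card B = 2"
    using basis_exists[of u] assms(2) by metis
  then obtain x y where xy: "B = {x, y}" "x \<noteq> y" by (meson card_2_iff)
  have u: "u = span {x, y}" using B xy assms(1) by (metis span_subspace)
  have "p = 0 \<and> q = 0" if "p *\<^sub>R x + q *\<^sub>R y = 0" for p q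
  proof -
    have "\<forall>f. (\<Sum>v\<in>{x, y}. f v *\<^sub>R v) = 0 \<longrightarrow> (\<forall>v\<in>{x, y}. f v = 0)"
      using B(2) xy independent_explicit_finite_subsets[of "{x,y}"] by blast
    from spec[OF this, of "\<lambda>v. if v = x then p else q"] show ?thesis using that xy by auto
  qed
  then show ?thesis using plane_basis_span(1) u by blast
qed

lemma matrix_diff_rdistrib:
  fixes x y :: "'a::ring_1^'n^'m"
  shows "(x - y) ** z = x ** z - y ** z"
  by (simp add: vec_eq_iff matrix_matrix_mult_def left_diff_distrib sum_subtractf)

lemma lie_bracket_simps:
  "lie_bracket (p *\<^sub>R x) y = p *\<^sub>R lie_bracket x y" "lie_bracket x (p *\<^sub>R y) = p *\<^sub>R lie_bracket x y"
  "lie_bracket (x + z) y = lie_bracket x y + lie_bracket z y"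
  "lie_bracket x (y + z) = lie_bracket x y + lie_bracket x z"
  "lie_bracket x x = 0" "lie_bracket x (- y) = - lie_bracket x y"
  by (simp_all add: lie_bracket_def vec_eq_iff matrix_matrix_mult_def scaleR_sum_right
      algebra_simps sum.distrib sum_negf)

lemma lie_bracket_anti: "lie_bracket x y = - lie_bracket y x"
  by (simp add: lie_bracket_def)

text \<open>The derived algebra is spanned by [x, y] = a x + b y. If this is nonzero, it serves as
  the new second basis vector, and x / b (or - y / a when b = 0) acts on it as the identity.\<close>

lemma plane_basis_lie_normal_form:
  assumes "plane_basis u x y" "lie_bracket x y \<in> u"
  shows "\<exists>x y. plane_basis u x y \<and> (lie_bracket x y = 0 \<or> lie_bracket x y = y)"
proof -
  obtain a b where ab: "lie_bracket x y = a *\<^sub>R x + b *\<^sub>R y"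
    using assms unfolding plane_basis_def by blast
  consider "b \<noteq> 0" | "b = 0" "a \<noteq> 0" | "b = 0" "a = 0" by blast
  then show ?thesis
  proof cases
    case 1
    have "plane_basis u (b *\<^sub>R y) ((1/b) *\<^sub>R x)"
      by (intro plane_basis_scale plane_basis_swap[OF plane_basis_scale] assms(1)) (use 1 in auto)
    from plane_basis_shear[OF plane_basis_swap[OF this]]
    have "plane_basis u ((1/b) *\<^sub>R x) (b *\<^sub>R y + (a * b) *\<^sub>R ((1/b) *\<^sub>R x))" .
    moreover have "b *\<^sub>R y + (a * b) *\<^sub>R ((1/b) *\<^sub>R x) = a *\<^sub>R x + b *\<^sub>R y" using 1 by simp
    moreover have "lie_bracket ((1/b) *\<^sub>R x) (a *\<^sub>R x + b *\<^sub>R y) = a *\<^sub>R x + b *\<^sub>R y"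
      using 1 by (simp add: lie_bracket_simps ab)
    ultimately show ?thesis by metis
  next
    case 2
    have "plane_basis u ((-1/a) *\<^sub>R y) (a *\<^sub>R x)"
      by (intro plane_basis_scale plane_basis_swap[OF plane_basis_scale] assms(1)) (use 2 in auto)
    moreover have "lie_bracket ((-1/a) *\<^sub>R y) (a *\<^sub>R x) = a *\<^sub>R x"
      using 2 ab by (subst lie_bracket_anti) (simp add: lie_bracket_simps)
    ultimately show ?thesis by metis
  next
    case 3
    then show ?thesis using ab assms(1) by auto
  qed
qed

section \<open>Characteristic polynomials and common eigenvectors in dimension three\<close>

lemma cubic_factorization:
  fixes p q r :: complex
  shows "\<exists>a b c. p = a + b + c \<and> q = a*b + b*c + c*a \<and> r = a*b*c"
proof -
  have "degree [:-r, q, -p, 1:] = 3" by simp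
  then have "\<not> constant (poly [:-r, q, -p, 1:])" by (simp add: constant_degree)
  then obtain a where "poly [:-r, q, -p, 1:] a = 0" using fundamental_theorem_of_algebra by blast
  then have a: "r = a * (q + a * (a - p))" by (simp add: algebra_simps)
  \<comment> \<open>This quadratic is the quotient of the cubic by the linear factor of its root a.
    Once b is one of its roots, the last root is p - a - b.\<close>
  have "degree [:q - a * (p - a), a - p, 1:] = 2" by simp
  then have "\<not> constant (poly [:q - a * (p - a), a - p, 1:])" by (simp add: constant_degree)
  then obtain b where "poly [:q - a * (p - a), a - p, 1:] b = 0"
    using fundamental_theorem_of_algebra by blast
  then have b: "q = a * (p - a) + b * (p - a - b)" by (simp add: algebra_simps)
  show ?thesis
    by (rule exI[of _ a], rule exI[of _ b], rule exI[of _ "p - a - b"])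
      (simp add: a, simp add: b algebra_simps)
qed

definition minor_sum :: "cmat3 \<Rightarrow> complex" where
  "minor_sum x = x$1$1 * x$2$2 - x$1$2 * x$2$1 + x$1$1 * x$3$3 - x$1$3 * x$3$1 + x$2$2 * x$3$3 - x$2$3 * x$3$2"

lemma vec3_eq_iff: "(v::complex^3) = w \<longleftrightarrow> v$1 = w$1 \<and> v$2 = w$2 \<and> v$3 = w$3"
  by (simp add: vec_eq_iff forall_3)

lemma mat3_vec: "(x *v v)$i = x$i$1 * v$1 + x$i$2 * v$2 + x$i$3 * (v::complex^3)$3"
  by (simp add: matrix_vector_mult_def sum_3)

lemma cayley_hamilton3:
  fixes x :: cmat3
  shows "x *v (x *v (x *v v)) = trace x *s (x *v (x *v v)) - minor_sum x *s (x *v v) + det x *s v"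
  by (simp add: vec3_eq_iff mat3_vec minor_sum_def trace_def sum_3 det_3 algebra_simps)

text \<open>Newton's identities: once the traces of the first three powers vanish, so do all lower
  coefficients of the characteristic polynomial, and Cayley-Hamilton makes the matrix
  nilpotent.\<close>

lemma newton3:
  fixes x :: cmat3
  shows "trace (x ** x) = trace x ^ 2 - 2 * minor_sum x"
    "trace (x ** x ** x) = trace x ^ 3 - 3 * trace x * minor_sum x + 3 * det x"
  by (simp_all add: minor_sum_def trace_def matrix_matrix_mult_def sum_3 det_3 power2_eq_square
      power3_eq_cube algebra_simps)

text \<open>By Cayley-Hamilton (x - a)(x - b)(x - c) kills v. Applying the factors one at a time
  stays inside \<open>V\<close>, and the last nonzero vector on the way is an eigenvector. Neither a
  basis of \<open>V\<close> nor a restriction of x is required.\<close>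

lemma eigenvector_in_invariant_subspace:
  fixes x :: cmat3
  assumes V: "vec.subspace V" "v \<in> V" "v \<noteq> 0" and x: "\<And>v. v \<in> V \<Longrightarrow> x *v v \<in> V"
  shows "\<exists>w\<in>V. w \<noteq> 0 \<and> (\<exists>c. x *v w = c *s w)"
proof -
  obtain a b c where abc: "trace x = a + b + c" "minor_sum x = a*b + b*c + c*a" "det x = a*b*c"
    using cubic_factorization by blast
  define f where "f k w = x *v w - k *s w" for k w
  have fV: "f k w \<in> V" if "w \<in> V" for k w
    unfolding f_def using V(1) x that by (simp add: vec.subspace_diff vec.subspace_scale)
  have "f a (f b (f c v)) = 0"
    unfolding f_def using cayley_hamilton3[of x v, unfolded abc]
    by (simp add: matrix_vector_mult_diff_distrib vector_scalar_commute)
      (simp add: vec3_eq_iff algebra_simps)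
  then have "\<exists>w\<in>V. w \<noteq> 0 \<and> (\<exists>k. f k w = 0)" using V fV by metis
  then show ?thesis unfolding f_def by auto
qed

text \<open>If \<open>[x, y] = y\<close> then the traces of the powers of \<open>y\<close> vanish, so \<open>y\<close> is nilpotent and its kernel meets every invariant subspace.\<close>

lemma common_eigenvector:
  fixes x y :: cmat3
  assumes V: "vec.subspace V" "v \<in> V" "v \<noteq> 0"
    and x: "\<And>v. v \<in> V \<Longrightarrow> x *v v \<in> V" and y: "\<And>v. v \<in> V \<Longrightarrow> y *v v \<in> V"
    and br: "lie_bracket x y = 0 \<or> lie_bracket x y = y"
  shows "\<exists>w\<in>V. w \<noteq> 0 \<and> (\<exists>a. x *v w = a *s w) \<and> (\<exists>b. y *v w = b *s w)"
proof -
  \<comment> \<open>Both cases reduce to an eigenspace of \<open>y\<close> that meets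
    \<open>V\<close> nontrivially and is stable under \<open>x\<close>; an eigenvector of
    \<open>x\<close> is then found in its intersection with \<open>V\<close>.\<close>
  have "\<exists>c. \<exists>w\<in>V. w \<noteq> 0 \<and> y *v w = c *s w \<and> (\<forall>w. y *v w = c *s w \<longrightarrow> y *v (x *v w) = c *s (x *v w))"
    using br
  proof
    assume "lie_bracket x y = 0"
    then have xy: "x ** y = y ** x" by (simp add: lie_bracket_def)
    obtain w c where "w \<in> V" "w \<noteq> 0" "y *v w = c *s w"
      using eigenvector_in_invariant_subspace[OF V y] by blast
    moreover have "y *v (x *v w) = c *s (x *v w)" if "y *v w = c *s w" for w
    proof -
      have "y *v (x *v w) = x *v (y *v w)" by (simp add: matrix_vector_mul_assoc xy)
      then show ?thesis by (simp add: that vector_scalar_commute)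
    qed
    ultimately show ?thesis by blast
  next
    assume "lie_bracket x y = y"
    then have xy: "y = x ** y - y ** x" by (simp add: lie_bracket_def)
    \<comment> \<open>Replacing one factor y of a power by xy - yx turns the trace of that power
      into a difference of two traces that are equal by cyclicity.\<close>
    have "trace y = 0"
      using trans[OF arg_cong[OF xy, of trace] trace_sub] trace_mul_sym[of x y] by simp
    moreover have "trace (y ** y) = 0"
    proof -
      have "trace (y ** y) = trace ((x ** y - y ** x) ** y)"
        by (rule arg_cong[OF xy, of "\<lambda>z. trace (z ** y)"])
      also have "\<dots> = trace (x ** (y ** y)) - trace (y ** (x ** y))"
        by (simp add: matrix_diff_rdistrib trace_sub matrix_mul_assoc)
      also have "\<dots> = 0" using trace_mul_sym[of "x ** y" y] by (simp add: matrix_mul_assoc)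
      finally show ?thesis .
    qed
    moreover have "trace (y ** y ** y) = 0"
    proof -
      have "trace (y ** y ** y) = trace ((x ** y - y ** x) ** (y ** y))"
        unfolding matrix_mul_assoc[symmetric] by (rule arg_cong[OF xy, of "\<lambda>z. trace (z ** (y ** y))"])
      also have "\<dots> = trace (x ** y ** y ** y) - trace (y ** (x ** y ** y))"
        by (simp add: matrix_diff_rdistrib trace_sub matrix_mul_assoc)
      also have "\<dots> = 0" using trace_mul_sym[of "x ** y ** y" y] by (simp add: matrix_mul_assoc)
      finally show ?thesis .
    qed
    ultimately have "trace y = 0" "minor_sum y = 0" "det y = 0" using newton3[of y] by simp_all
    then have "y *v (y *v (y *v v)) = 0"
      using cayley_hamilton3[of y v] by simp
    then obtain w where "w \<in> V" "w \<noteq> 0" "y *v w = 0" using V(2,3) y[of v] y[of "y *v v"] by blast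
    moreover have "y *v (x *v w) = 0" if "y *v w = 0" for w
    proof -
      have "y + y ** x = x ** y"
        by (rule iffD1[OF eq_diff_eq xy])
      then have "(y + y ** x) *v w = (x ** y) *v w" by simp
      then show ?thesis
        by (simp add: that matrix_vector_mult_add_rdistrib flip: matrix_vector_mul_assoc)
    qed
    ultimately show ?thesis by (intro exI[of _ 0] bexI[of _ w]) simp_all
  qed
  then obtain c w where w: "w \<in> V" "w \<noteq> 0" "y *v w = c *s w"
    and c: "\<And>w. y *v w = c *s w \<Longrightarrow> y *v (x *v w) = c *s (x *v w)" by blast
  let ?V = "V \<inter> {w. y *v w = c *s w}"
  have "vec.subspace ?V"
    using V(1) by (auto simp: vec.subspace_def matrix_vector_right_distrib vector_scalar_commute
        vec.scale_right_distrib vector_smult_assoc mult.commute)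
  moreover have "w \<in> ?V" "\<And>v. v \<in> ?V \<Longrightarrow> x *v v \<in> ?V" using w c x by blast+
  ultimately obtain w' where "w' \<in> ?V" "w' \<noteq> 0" "\<exists>a. x *v w' = a *s w'"
    using eigenvector_in_invariant_subspace[of ?V w x] w(2) by blast
  then show ?thesis by blast
qed

section \<open>Planes of upper triangular matrices\<close>

text \<open>The outer basis vectors are isotropic and paired with each other. A skew-adjoint map
  fixing the first line also fixes its orthogonal complement, the span of the first two vectors,
  hence is upper triangular.\<close>

definition J21 :: cmat3 where "J21 = mat3 0 0 1 0 1 0 1 0 0"

text \<open>The general upper triangular element of the Lie algebra of the form \<open>J21\<close>: \<open>r\<close> is the
  split torus, \<open>s\<close> the compact one, and \<open>z\<close>, \<open>t\<close> are Heisenberg coordinates with centre \<open>t\<close>.\<close>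

definition borel_mat :: "real \<Rightarrow> real \<Rightarrow> complex \<Rightarrow> real \<Rightarrow> cmat3" where
  "borel_mat r s z t =
     mat3 (Complex r s) z (Complex 0 t) 0 (Complex 0 (- 2 * s)) (- cnj z) 0 0 (Complex (- r) s)"

lemma borel_linear:
  "borel_mat r s z t + borel_mat r' s' z' t' = borel_mat (r + r') (s + s') (z + z') (t + t')"
  "p *\<^sub>R borel_mat r s z t = borel_mat (p * r) (p * s) (of_real p * z) (p * t)"
  "borel_mat r s z t = 0 \<longleftrightarrow> r = 0 \<and> s = 0 \<and> z = 0 \<and> t = 0"
  "borel_mat r s z t = borel_mat r' s' z' t' \<longleftrightarrow> r = r' \<and> s = s' \<and> z = z' \<and> t = t'"
  by (auto simp: borel_mat_def mat3_consts complex_eq_iff)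

text \<open>The 3 in the weight r + 3is is the difference of the diagonal entries r + is and -2is;
  the imaginary part of z' times the conjugate of z is the symplectic form of the Heisenberg
  algebra.\<close>

lemma borel_bracket:
  "lie_bracket (borel_mat r s z t) (borel_mat r' s' z' t') =
   borel_mat 0 0 (Complex r (3 * s) * z' - Complex r' (3 * s') * z) (2 * (r * t' - r' * t + Im (z' * cnj z)))"
  by (simp add: lie_bracket_def borel_mat_def complex_eq_iff algebra_simps)

text \<open>Determinants are left free: the transformation will be absorbed into a frame, and
  \<open>isometric_frames_conjugate\<close> corrects the phase.\<close>

definition J_equiv :: "cmat3 set \<Rightarrow> cmat3 set \<Rightarrow> bool" where
  "J_equiv u v \<longleftrightarrow> (\<exists>T. conj_transpose T ** J21 ** T = J21 \<and> SU21_act T u = v)"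

lemma invertible_of_form:
  assumes "conj_transpose T ** G ** T = G'" "det G' \<noteq> 0"
  shows "invertible (T :: cmat3)"
  using assms by (auto simp: invertible_det_complex det_mul det_conj_transpose)

lemma det_J21: "det J21 \<noteq> 0"
  by (simp add: J21_def)

lemma J_equiv_trans:
  assumes "J_equiv u v" "J_equiv v w"
  shows "J_equiv u w"
proof -
  obtain S T where S: "conj_transpose S ** J21 ** S = J21" "SU21_act S u = v"
    and T: "conj_transpose T ** J21 ** T = J21" "SU21_act T v = w"
    using assms unfolding J_equiv_def by blast
  have "conj_transpose (T ** S) ** J21 ** (T ** S)
      = conj_transpose S ** (conj_transpose T ** J21 ** T) ** S"
    by (simp add: conj_transpose_mult matrix_mul_assoc)
  then have "conj_transpose (T ** S) ** J21 ** (T ** S) = J21" using S T by simp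
  moreover have "SU21_act (T ** S) u = w"
    using S T invertible_of_form det_J21 by (metis SU21_act_act)
  ultimately show ?thesis unfolding J_equiv_def by blast
qed

section \<open>Transport of planes along intertwining matrices\<close>

lemma conj_eqI:
  assumes "invertible (T::cmat3)" "T ** x = x' ** T"
  shows "T ** x ** matrix_inv T = x'"
  using assms by (simp add: matrix_inv_cancel)

lemma matrix_add_rdistrib:
  fixes x y :: "'a::semiring_1^'n^'m"
  shows "(x + y) ** z = x ** z + y ** z"
  by (simp add: vec_eq_iff matrix_matrix_mult_def distrib_right sum.distrib)

lemma matrix_diff_ldistrib:
  fixes x y :: "'a::ring_1^'n^'m"
  shows "z ** (x - y) = z ** x - z ** y"
  by (simp add: vec_eq_iff matrix_matrix_mult_def right_diff_distrib sum_subtractf)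

text \<open>The relation \<open>T ** x = x' ** T\<close> is polynomial in the entries, so concrete
  instances are checked without computing an inverse.\<close>

lemma act_plane_basis:
  assumes "plane_basis u x y" "invertible T" "T ** x = x' ** T" "T ** y = y' ** T"
  shows "plane_basis (SU21_act T u) x' y'"
proof -
  have lin: "T ** (p *\<^sub>R x + q *\<^sub>R y) ** matrix_inv T = p *\<^sub>R x' + q *\<^sub>R y'" for p q
    by (rule conj_eqI[OF assms(2)])
      (simp add: matrix_add_ldistrib matrix_add_rdistrib matrix_scalar_ac assms flip: scalar_matrix_assoc)
  have "p = 0 \<and> q = 0" if "p *\<^sub>R x' + q *\<^sub>R y' = 0" for p q
  proof -
    have "matrix_inv T ** (T ** (p *\<^sub>R x + q *\<^sub>R y) ** matrix_inv T) ** T = 0"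
      unfolding lin that by (simp add: vec_eq_iff matrix_matrix_mult_def)
    then have "p *\<^sub>R x + q *\<^sub>R y = 0"
      using assms(2) by (simp add: matrix_inv_cancel matrix_mul_assoc)
    then show ?thesis using assms(1) unfolding plane_basis_def by blast
  qed
  moreover have "SU21_act T u = {p *\<^sub>R x' + q *\<^sub>R y' |p q. True}"
  proof -
    have "u = {p *\<^sub>R x + q *\<^sub>R y |p q. True}" using assms(1) by (simp add: plane_basis_def)
    then have "SU21_act T u = {T ** (p *\<^sub>R x + q *\<^sub>R y) ** matrix_inv T |p q. True}"
      unfolding SU21_act_def by blast
    then show ?thesis unfolding lin .
  qed
  ultimately show ?thesis unfolding plane_basis_def by blast
qed

lemma act_bracket:
  assumes "lie_bracket x y \<in> u" "invertible T" "T ** x = x' ** T" "T ** y = y' ** T"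
  shows "lie_bracket x' y' \<in> SU21_act T u"
proof -
  have "T ** lie_bracket x y ** matrix_inv T = lie_bracket x' y'"
  proof (rule conj_eqI[OF assms(2)])
    have "T ** (x ** y) = x' ** y' ** T" "T ** (y ** x) = y' ** x' ** T"
      unfolding matrix_mul_assoc assms(3,4) unfolding matrix_mul_assoc[symmetric] assms(3,4) by (rule refl)+
    then show "T ** lie_bracket x y = lie_bracket x' y' ** T"
      by (simp add: lie_bracket_def matrix_diff_rdistrib matrix_diff_ldistrib)
  qed
  then show ?thesis using assms(1) unfolding SU21_act_def by (metis imageI)
qed

text \<open>The Heisenberg group in coordinates: preserving \<open>J21\<close> forces the real part
  -|w|^2 / 2 of the corner entry and leaves its imaginary part \<tau> free, the central
  coordinate.\<close>

definition unipotent :: "complex \<Rightarrow> real \<Rightarrow> cmat3" where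
  "unipotent w \<tau> = mat3 1 w (Complex (- ((Re w)\<^sup>2 + (Im w)\<^sup>2) / 2) \<tau>) 0 1 (- cnj w) 0 0 1"

lemma unipotent_form: "conj_transpose (unipotent w \<tau>) ** J21 ** unipotent w \<tau> = J21"
  by (simp add: unipotent_def J21_def complex_eq_iff power2_eq_square)

text \<open>The choice of w can cancel z as soon as the weight r + 3is is nonzero, whereas \<tau>
  moves t only if r is nonzero.\<close>

lemma unipotent_borel:
  "unipotent w \<tau> ** borel_mat r s z t =
   borel_mat r s (z - Complex r (3 * s) * w) (t + 2 * Im (z * cnj w) - 3 * s * ((Re w)\<^sup>2 + (Im w)\<^sup>2) - 2 * r * \<tau>)
     ** unipotent w \<tau>"
  by (simp add: unipotent_def borel_mat_def complex_eq_iff) (simp add: field_simps power2_eq_square)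

text \<open>Needed only to make the coordinate z real and positive; its modulus is afterwards
  absorbed by rescaling the basis vector.\<close>

definition rotation :: "complex \<Rightarrow> cmat3" where
  "rotation c = mat3 1 0 0 0 c 0 0 0 1"

lemma rotation_form:
  assumes "cmod c = 1"
  shows "conj_transpose (rotation c) ** J21 ** rotation c = J21"
  using assms by (simp add: rotation_def J21_def complex_norm_square[symmetric] mult.commute[of "cnj c"])

lemma rotation_borel:
  assumes "cmod c = 1"
  shows "rotation c ** borel_mat r s z t = borel_mat r s (z * cnj c) t ** rotation c"
  using assms by (simp add: rotation_def borel_mat_def complex_norm_square[symmetric] mult.assoc mult.commute[of "cnj c"])

lemma unipotent_act:
  assumes "plane_basis u (borel_mat r s z t) (borel_mat r' s' z' t')"
    and "lie_bracket (borel_mat r s z t) (borel_mat r' s' z' t') \<in> u"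
    and "r = 1 \<or> r = 0 \<and> s = 1 \<and> r' = 0"
  shows "\<exists>v t1 z'' t''. J_equiv u v \<and> (r \<noteq> 0 \<longrightarrow> t1 = 0) \<and>
           plane_basis v (borel_mat r s 0 t1) (borel_mat r' s' z'' t'') \<and>
           lie_bracket (borel_mat r s 0 t1) (borel_mat r' s' z'' t'') \<in> v"
proof -
  define k where "k = Complex r (3 * s)"
  define w where "w = z / k"
  \<comment> \<open>For nonzero r this solves the equation that the new central coordinate is 0. For
    r = 0 its coefficient 2r vanishes, the choice 0 is arbitrary, and \<open>t1\<close>
    survives.\<close>
  define \<tau> where "\<tau> = (if r = 0 then 0 else (t + 2 * Im (z * cnj w) - 3 * s * ((Re w)\<^sup>2 + (Im w)\<^sup>2)) / (2 * r))"
  have "k \<noteq> 0" using assms(3) by (auto simp: k_def complex_eq_iff)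
  then have w: "z - k * w = 0" by (simp add: w_def)
  let ?T = "unipotent w \<tau>"
  have T: "invertible ?T" by (rule invertible_of_form[OF unipotent_form det_J21])
  let ?n = "(Re w)\<^sup>2 + (Im w)\<^sup>2"
  let ?t1 = "t + 2 * Im (z * cnj w) - 3 * s * ?n - 2 * r * \<tau>"
  let ?z = "z' - Complex r' (3 * s') * w"
  let ?t2 = "t' + 2 * Im (z' * cnj w) - 3 * s' * ?n - 2 * r' * \<tau>"
  have "J_equiv u (SU21_act ?T u)"
    unfolding J_equiv_def using unipotent_form by blast
  moreover have "r \<noteq> 0 \<longrightarrow> ?t1 = 0" by (simp add: \<tau>_def)
  moreover have "plane_basis (SU21_act ?T u) (borel_mat r s 0 ?t1) (borel_mat r' s' ?z ?t2)"
    using act_plane_basis[OF assms(1) T unipotent_borel unipotent_borel] w unfolding k_def by simp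
  moreover have "lie_bracket (borel_mat r s 0 ?t1) (borel_mat r' s' ?z ?t2) \<in> SU21_act ?T u"
    using act_bracket[OF assms(2) T unipotent_borel unipotent_borel] w unfolding k_def by simp
  ultimately show ?thesis by blast
qed

lemma rotation_act:
  assumes "plane_basis u (borel_mat r s 0 t) (borel_mat 0 s' z' t')" "z' \<noteq> 0"
  shows "\<exists>v. J_equiv u v \<and> plane_basis v (borel_mat r s 0 t) (borel_mat 0 s' (cmod z') t')"
proof -
  define c where "c = z' / cmod z'"
  have c: "cmod c = 1" using assms(2) by (simp add: c_def norm_divide)
  have T: "invertible (rotation c)" by (rule invertible_of_form[OF rotation_form det_J21]) (rule c)
  have z: "z' * cnj c = cmod z'"
    using assms(2) by (simp add: c_def complex_norm_square[symmetric] power2_eq_square)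
  have "J_equiv u (SU21_act (rotation c) u)"
    unfolding J_equiv_def using rotation_form[OF c] by blast
  then show ?thesis
    using act_plane_basis[OF assms(1) T rotation_borel rotation_borel] c z by auto
qed

text \<open>\<open>V23\<close> alone refers to an orthonormal frame, all others to a frame with Gram
  matrix \<open>J21\<close>. In the latter, \<open>V21\<close> is a real line plus the centre of the
  Heisenberg algebra, \<open>V24\<close> the full torus, and \<open>V25\<close> the split torus with
  a real Heisenberg line. The slope -2\<mu> matches the parameter of the list.\<close>

fun model :: "entry \<Rightarrow> cmat3 set" where
  "model V21 = {borel_mat 0 0 (of_real p) q |p q. True}"
| "model V22 = {borel_mat 0 p 0 q |p q. True}"
| "model V23 = {mat3 (\<i> * of_real p) 0 0 0 (\<i> * of_real q) 0 0 0 (- \<i> * (of_real p + of_real q)) |p q. True}"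
| "model V24 = {borel_mat p q 0 0 |p q. True}"
| "model V25 = {borel_mat p 0 (of_real q) 0 |p q. True}"
| "model (V26 \<mu>) = {borel_mat p (- 2 * \<mu> * p) 0 q |p q. True}"

lemma plane_basis_eq:
  assumes "plane_basis u x y" "plane_basis v x y"
  shows "u = v"
  using assms by (simp add: plane_basis_def)

lemma plane_basis_model:
  "plane_basis (model V21) (borel_mat 0 0 1 0) (borel_mat 0 0 0 1)"
  "plane_basis (model V22) (borel_mat 0 1 0 0) (borel_mat 0 0 0 1)"
  "plane_basis (model V24) (borel_mat 1 0 0 0) (borel_mat 0 1 0 0)"
  "plane_basis (model V25) (borel_mat 1 0 0 0) (borel_mat 0 0 1 0)"
  "plane_basis (model (V26 \<mu>)) (borel_mat 1 (- 2 * \<mu>) 0 0) (borel_mat 0 0 0 1)"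
  by (auto simp: plane_basis_def borel_linear algebra_simps)

section \<open>Classification of the planes of upper triangular matrices\<close>

lemma plane_basis_nonzero:
  assumes "plane_basis u x y"
  shows "x \<noteq> 0" "y \<noteq> 0"
proof -
  have *: "p = 0 \<and> q = 0" if "p *\<^sub>R x + q *\<^sub>R y = 0" for p q
    using assms that unfolding plane_basis_def by blast
  show "x \<noteq> 0" "y \<noteq> 0" using *[of 1 0] *[of 0 1] by auto
qed

lemma plane_basis_scaleR_mem:
  assumes "plane_basis u x y" "z \<in> u"
  shows "c *\<^sub>R z \<in> u"
proof -
  obtain p q where "z = p *\<^sub>R x + q *\<^sub>R y" using assms unfolding plane_basis_def by blast
  then have "c *\<^sub>R z = (c * p) *\<^sub>R x + (c * q) *\<^sub>R y" by (simp add: scaleR_right_distrib)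
  then show ?thesis using plane_basis_mem(1)[OF assms(1)] by simp
qed

lemma plane_basis_scale2:
  assumes "plane_basis u x y" "c \<noteq> 0"
  shows "plane_basis u x (c *\<^sub>R y)"
  using assms plane_basis_scale plane_basis_swap by metis

text \<open>With the first vector reduced to the torus element 1, s, the second must satisfy [x, y]
  = q y with q real. Weight 0 leads to \<open>V24\<close>, weight 1 + 3is to \<open>V25\<close>, and
  the central weight 2 to \<open>V26\<close>.\<close>

lemma borel_classification_hyperbolic:
  assumes "plane_basis u (borel_mat r s z t) (borel_mat r' s' z' t')"
    and "lie_bracket (borel_mat r s z t) (borel_mat r' s' z' t') \<in> u" and "r \<noteq> 0"
  shows "\<exists>e. J_equiv u (model e) \<and> e \<noteq> V23"
proof -
  have "\<exists>s z t s' z' t'. plane_basis u (borel_mat 1 s z t) (borel_mat 0 s' z' t') \<and>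
      lie_bracket (borel_mat 1 s z t) (borel_mat 0 s' z' t') \<in> u"
  proof -
    let ?x = "(1 / r) *\<^sub>R borel_mat r s z t"
    let ?y = "borel_mat r' s' z' t' + (- r') *\<^sub>R ?x"
    have *: "plane_basis u ?x ?y"
      using assms by (intro plane_basis_shear plane_basis_scale) auto
    have "lie_bracket ?x ?y = (1 / r) *\<^sub>R lie_bracket (borel_mat r s z t) (borel_mat r' s' z' t')"
      by (simp add: lie_bracket_simps del: scaleR_minus_left)
    then have "lie_bracket ?x ?y \<in> u"
      using plane_basis_scaleR_mem[OF assms(1,2)] by simp
    with * show ?thesis using assms(3) by (simp add: borel_linear) blast
  qed
  then obtain s z t s' z' t' where "plane_basis u (borel_mat 1 s z t) (borel_mat 0 s' z' t')"
      "lie_bracket (borel_mat 1 s z t) (borel_mat 0 s' z' t') \<in> u" by blast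
  from unipotent_act[OF this] obtain v z'' t'' where v: "J_equiv u v"
      "plane_basis v (borel_mat 1 s 0 0) (borel_mat 0 s' z'' t'')"
      "lie_bracket (borel_mat 1 s 0 0) (borel_mat 0 s' z'' t'') \<in> v" by auto
  from v(2,3) obtain p q where "lie_bracket (borel_mat 1 s 0 0) (borel_mat 0 s' z'' t'')
      = p *\<^sub>R borel_mat 1 s 0 0 + q *\<^sub>R borel_mat 0 s' z'' t''" unfolding plane_basis_def by blast
  then have pq: "p = 0" "q * s' = 0" "Complex 1 (3 * s) * z'' = q * z''" "2 * t'' = q * t''"
    by (auto simp: borel_bracket borel_linear)
  have nz: "s' \<noteq> 0 \<or> z'' \<noteq> 0 \<or> t'' \<noteq> 0"
    using plane_basis_nonzero[OF v(2)] by (auto simp: borel_linear)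
  consider "s' \<noteq> 0" | "s' = 0" "z'' \<noteq> 0" | "s' = 0" "z'' = 0" by blast
  then show ?thesis
  proof cases
    case 1
    with pq have "Complex 1 (3 * s) * z'' = 0" "t'' = 0" by auto
    moreover have "Complex 1 (3 * s) \<noteq> 0" by (simp add: complex_eq_iff)
    ultimately have z: "z'' = 0" "t'' = 0" by auto
    have "plane_basis v (borel_mat 1 s 0 0 + (- s) *\<^sub>R (1 / s') *\<^sub>R borel_mat 0 s' z'' t'') ((1 / s') *\<^sub>R borel_mat 0 s' z'' t'')"
      by (rule plane_basis_swap, rule plane_basis_shear, rule plane_basis_scale,
          rule plane_basis_swap[OF v(2)]) (use 1 in auto)
    then have "plane_basis v (borel_mat 1 0 0 0) (borel_mat 0 1 0 0)"
      using 1 z by (simp add: borel_linear del: scaleR_minus_left)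
    then have "v = model V24" using plane_basis_eq plane_basis_model by blast
    with v(1) show ?thesis by blast
  next
    case 2
    \<comment> \<open>Since q is real, s = 0 and q = 1; then 2t'' = t'' removes the central
      part.\<close>
    with pq have "Complex 1 (3 * s) = q" by simp
    then have s: "s = 0" "t'' = 0" using pq by (auto simp: complex_eq_iff)
    from rotation_act[of v 1 s 0 s' z'' t''] v(2) 2 obtain v' where v': "J_equiv v v'"
      "plane_basis v' (borel_mat 1 s 0 0) (borel_mat 0 s' (cmod z'') t'')" by auto
    from plane_basis_scale2[OF v'(2), of "1 / cmod z''"] 2 s
    have "plane_basis v' (borel_mat 1 0 0 0) (borel_mat 0 0 1 0)" by (simp add: borel_linear)
    then have "v' = model V25" using plane_basis_eq plane_basis_model by blast
    with v(1) v'(1) show ?thesis using J_equiv_trans by blast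
  next
    case 3
    with nz have "t'' \<noteq> 0" by simp
    with plane_basis_scale2[OF v(2), of "1 / t''"] 3
    \<comment> \<open>The ratio s of the torus parameters equals -2\<mu>, hence \<mu> = - s /
      2.\<close>
    have "plane_basis v (borel_mat 1 (-2 * (- s / 2)) 0 0) (borel_mat 0 0 0 1)" by (simp add: borel_linear)
    then have "v = model (V26 (- s / 2))" using plane_basis_eq plane_basis_model by blast
    with v(1) show ?thesis by blast
  qed
qed

text \<open>The compact generator acts on the Heisenberg coordinate by 3i, which is not real, so the
  second vector must be central. The leftover \<open>t1\<close> is then removed by subtracting a
  multiple of it.\<close>

lemma borel_classification_elliptic:
  assumes "plane_basis u (borel_mat 0 s z t) (borel_mat 0 s' z' t')"
    and "lie_bracket (borel_mat 0 s z t) (borel_mat 0 s' z' t') \<in> u" and "s \<noteq> 0"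
  shows "J_equiv u (model V22)"
proof -
  have "\<exists>z t z' t'. plane_basis u (borel_mat 0 1 z t) (borel_mat 0 0 z' t') \<and>
      lie_bracket (borel_mat 0 1 z t) (borel_mat 0 0 z' t') \<in> u"
  proof -
    let ?x = "(1 / s) *\<^sub>R borel_mat 0 s z t"
    let ?y = "borel_mat 0 s' z' t' + (- s') *\<^sub>R ?x"
    have *: "plane_basis u ?x ?y"
      using assms by (intro plane_basis_shear plane_basis_scale) auto
    have "lie_bracket ?x ?y = (1 / s) *\<^sub>R lie_bracket (borel_mat 0 s z t) (borel_mat 0 s' z' t')"
      by (simp add: lie_bracket_simps del: scaleR_minus_left)
    then have "lie_bracket ?x ?y \<in> u"
      using plane_basis_scaleR_mem[OF assms(1,2)] by simp
    with * show ?thesis using assms(3) by (simp add: borel_linear) blast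
  qed
  then obtain z t z' t' where "plane_basis u (borel_mat 0 1 z t) (borel_mat 0 0 z' t')"
      "lie_bracket (borel_mat 0 1 z t) (borel_mat 0 0 z' t') \<in> u" by blast
  from unipotent_act[OF this] obtain v t1 z'' t'' where v: "J_equiv u v"
      "plane_basis v (borel_mat 0 1 0 t1) (borel_mat 0 0 z'' t'')"
      "lie_bracket (borel_mat 0 1 0 t1) (borel_mat 0 0 z'' t'') \<in> v" by auto
  from v(2,3) obtain p q where "lie_bracket (borel_mat 0 1 0 t1) (borel_mat 0 0 z'' t'')
      = p *\<^sub>R borel_mat 0 1 0 t1 + q *\<^sub>R borel_mat 0 0 z'' t''" unfolding plane_basis_def by blast
  then have "Complex 0 3 * z'' = q * z''"
    by (auto simp: borel_bracket borel_linear)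
  then have "(Complex 0 3 - q) * z'' = 0" by (simp add: algebra_simps)
  moreover have "Complex 0 3 - q \<noteq> 0" by (simp add: complex_eq_iff)
  ultimately have z: "z'' = 0" by simp
  have t: "t'' \<noteq> 0"
    using plane_basis_nonzero[OF v(2)] z by (auto simp: borel_linear)
  have "plane_basis v (borel_mat 0 1 0 t1 + (- t1) *\<^sub>R (1 / t'') *\<^sub>R borel_mat 0 0 z'' t'') ((1 / t'') *\<^sub>R borel_mat 0 0 z'' t'')"
    by (rule plane_basis_swap, rule plane_basis_shear, rule plane_basis_scale,
        rule plane_basis_swap[OF v(2)]) (use t in auto)
  then have "plane_basis v (borel_mat 0 1 0 0) (borel_mat 0 0 0 1)"
    using t z by (simp add: borel_linear del: scaleR_minus_left)
  then have "v = model V22" using plane_basis_eq plane_basis_model by blast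
  with v(1) show ?thesis by blast
qed

text \<open>If z and z' were linearly independent over the reals, the bracket would be a nonzero
  central element, while the plane would contain none. So they are proportional and the plane
  contains the centre.\<close>

lemma borel_classification_nilpotent:
  assumes "plane_basis u (borel_mat 0 0 z t) (borel_mat 0 0 z' t')"
    and "lie_bracket (borel_mat 0 0 z t) (borel_mat 0 0 z' t') \<in> u" and "z \<noteq> 0"
  shows "J_equiv u (model V21)"
proof -
  obtain p q where "lie_bracket (borel_mat 0 0 z t) (borel_mat 0 0 z' t')
      = p *\<^sub>R borel_mat 0 0 z t + q *\<^sub>R borel_mat 0 0 z' t'"
    using assms(1,2) unfolding plane_basis_def by blast
  then have pq: "of_real p * z + of_real q * z' = 0" "2 * Im (z' * cnj z) = p * t + q * t'"
    by (auto simp: borel_bracket borel_linear Complex_eq)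
  \<comment> \<open>Multiplying p z + q z' = 0 by the conjugate of z makes the first summand real,
    so the imaginary part isolates the second.\<close>
  have "q * Im (z' * cnj z) = Im ((p * z + q * z') * cnj z)"
    by (simp add: algebra_simps)
  also have "\<dots> = 0" by (simp only: pq(1)) simp
  finally have "q = 0 \<or> Im (z' * cnj z) = 0" by simp
  with pq assms(3) have im: "Im (z' * cnj z) = 0" by auto
  define c where "c = Re (z' * cnj z) / (cmod z)\<^sup>2"
  have "z' * cnj z = of_real (c * (cmod z)\<^sup>2)"
    using im assms(3) by (simp add: c_def complex_eq_iff)
  also have "\<dots> = of_real c * z * cnj z" by (simp only: of_real_mult complex_norm_square mult.assoc)
  finally have z': "z' = of_real c * z" using assms(3) by simp
  from plane_basis_shear[OF assms(1), of "- c"]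
  have y: "plane_basis u (borel_mat 0 0 z t) (borel_mat 0 0 0 (t' - c * t))"
    by (simp add: borel_linear z' del: scaleR_minus_left)
  then have t: "t' - c * t \<noteq> 0"
    using plane_basis_nonzero by (fastforce simp: borel_linear)
  have "plane_basis u ((1 / (t' - c * t)) *\<^sub>R borel_mat 0 0 0 (t' - c * t))
     (borel_mat 0 0 z t + (- t) *\<^sub>R ((1 / (t' - c * t)) *\<^sub>R borel_mat 0 0 0 (t' - c * t)))"
    by (rule plane_basis_shear, rule plane_basis_scale, rule plane_basis_swap[OF y])
      (use t in auto)
  then have "plane_basis u (borel_mat 0 0 0 1) (borel_mat 0 0 z 0)"
    using t by (simp add: borel_linear del: scaleR_minus_left)
  from rotation_act[OF this assms(3)] obtain v where v: "J_equiv u v"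
      "plane_basis v (borel_mat 0 0 0 1) (borel_mat 0 0 (cmod z) 0)" by blast
  from plane_basis_scale2[OF v(2), of "1 / cmod z"] assms(3)
  have "plane_basis v (borel_mat 0 0 0 1) (borel_mat 0 0 1 0)" by (simp add: borel_linear)
  then have "v = model V21" using plane_basis_eq plane_basis_model plane_basis_swap by blast
  with v(1) show ?thesis by blast
qed

lemma borel_classification:
  assumes u: "plane_basis u (borel_mat r s z t) (borel_mat r' s' z' t')"
    and br: "lie_bracket (borel_mat r s z t) (borel_mat r' s' z' t') \<in> u"
  shows "\<exists>e. J_equiv u (model e) \<and> e \<noteq> V23"
proof -
  have u': "plane_basis u (borel_mat r' s' z' t') (borel_mat r s z t)" by (rule plane_basis_swap[OF u])
  have br': "lie_bracket (borel_mat r' s' z' t') (borel_mat r s z t) \<in> u"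
    using plane_basis_scaleR_mem[OF u br, of "- 1"] by (subst lie_bracket_anti) simp
  consider "r \<noteq> 0" | "r' \<noteq> 0" | "r = 0" "r' = 0" "s \<noteq> 0" | "r = 0" "r' = 0" "s' \<noteq> 0"
    | "r = 0" "r' = 0" "s = 0" "s' = 0" "z \<noteq> 0" | "r = 0" "r' = 0" "s = 0" "s' = 0" "z' \<noteq> 0"
    | "r = 0" "r' = 0" "s = 0" "s' = 0" "z = 0" "z' = 0" by blast
  then show ?thesis
  proof cases
    case 7
    \<comment> \<open>Both vectors lie in the one-dimensional centre and cannot be
      independent.\<close>
    then have "t' *\<^sub>R borel_mat r s z t + (- t) *\<^sub>R borel_mat r' s' z' t' = 0"
      by (simp add: borel_linear del: scaleR_minus_left)
    then have "- t = 0" using u unfolding plane_basis_def by blast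
    then show ?thesis using 7 plane_basis_nonzero(1)[OF u] by (simp add: borel_linear)
  next
    case 1
    then show ?thesis by (rule borel_classification_hyperbolic[OF u br])
  next
    case 2
    then show ?thesis by (rule borel_classification_hyperbolic[OF u' br'])
  next
    case 3
    then show ?thesis using borel_classification_elliptic u br by blast
  next
    case 4
    then show ?thesis using borel_classification_elliptic u' br' by blast
  next
    case 5
    then show ?thesis using borel_classification_nilpotent u br by blast
  next
    case 6
    then show ?thesis using borel_classification_nilpotent u' br' by blast
  qed
qed

section \<open>Adapted frames of the Hermitian space\<close>

definition herm :: "complex^3 \<Rightarrow> complex^3 \<Rightarrow> complex" where
  "herm v w = v$1 * cnj (w$1) + v$2 * cnj (w$2) - v$3 * cnj (w$3)"

lemma herm_linear:
  "herm (v + w) z = herm v z + herm w z" "herm (c *s v) z = c * herm v z"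
  "herm v (c *s z) = cnj c * herm v z" "herm 0 z = 0"
  by (simp_all add: herm_def algebra_simps)

lemma herm_cnj: "cnj (herm v w) = herm w v"
  by (simp add: herm_def mult.commute)

lemma herm_eq_0_sym: "herm v w = 0 \<Longrightarrow> herm w v = 0"
  by (metis complex_cnj_zero herm_cnj)

lemma herm_self: "herm v v = of_real (Re (herm v v))"
  by (simp add: herm_def complex_eq_iff)

lemma su21_skew:
  assumes "x \<in> su21"
  shows "herm (x *v v) w = - herm v (x *v w)"
proof -
  obtain a b c d e f g h i where x: "x = mat3 a b c d e f g h i"
    using mat3_expand by blast
  from assms have *: "cnj a + a = 0" "cnj d + b = 0" "- cnj g + c = 0" "cnj e + e = 0" "- cnj h + f = 0"
      "- cnj i + - i = 0"
    by (simp_all add: su21_iff x mat3_consts)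
  have "cnj a = - a" by (rule iffD2[OF eq_neg_iff_add_eq_0 *(1)])
  moreover have "cnj d = - b" by (rule iffD2[OF eq_neg_iff_add_eq_0 *(2)])
  moreover have "c = cnj g" using *(3) by simp
  moreover have "cnj e = - e" by (rule iffD2[OF eq_neg_iff_add_eq_0 *(4)])
  moreover have "f = cnj h" using *(5) by simp
  moreover have "cnj i = - i" using *(6) by (metis add.inverse_inverse eq_neg_iff_add_eq_0)
  moreover have "cnj b = - d" using \<open>cnj d = - b\<close> by (metis complex_cnj_cnj complex_cnj_minus minus_minus)
  ultimately show ?thesis by (simp add: herm_def mat3_vec x algebra_simps)
qed

text \<open>Two linear equations in three unknowns; the zero row pads them to a singular square
  matrix.\<close>

lemma orthogonal_vector_exists: "\<exists>z. z \<noteq> 0 \<and> herm z v = 0 \<and> herm z w = 0"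
proof -
  let ?M = "mat3 (cnj (v$1)) (cnj (v$2)) (- cnj (v$3)) (cnj (w$1)) (cnj (w$2)) (- cnj (w$3)) 0 0 0"
  have "det ?M = 0" by simp
  then have "\<not> invertible ?M" by (simp only: invertible_det_complex simp_thms)
  then obtain z where "z \<noteq> 0" "?M *v z = 0"
    unfolding invertible_left_inverse matrix_left_invertible_ker by blast
  then show ?thesis by (auto simp: vec3_eq_iff mat3_vec herm_def mult.commute)
qed

text \<open>The form has a single negative direction. Orthogonality equates the third coordinates
  with an inner product in the first two, and Cauchy-Schwarz there contradicts both norms being
  negative.\<close>

lemma herm_negative_orthogonal:
  assumes "Re (herm v v) < 0" "Re (herm w w) < 0"
  shows "herm v w \<noteq> 0"
proof
  assume "herm v w = 0"
  then have "v$3 * cnj (w$3) = v$1 * cnj (w$1) + v$2 * cnj (w$2)" by (simp add: herm_def)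
  then have "(cmod (v$3 * cnj (w$3)))\<^sup>2 = (cmod (v$1 * cnj (w$1) + v$2 * cnj (w$2)))\<^sup>2" by simp
  \<comment> \<open>Lagrange's identity, which gives Cauchy-Schwarz after dropping a square.\<close>
  moreover have "(cmod (v$1 * cnj (w$1) + v$2 * cnj (w$2)))\<^sup>2 + (cmod (v$1 * w$2 - v$2 * w$1))\<^sup>2
      = ((cmod (v$1))\<^sup>2 + (cmod (v$2))\<^sup>2) * ((cmod (w$1))\<^sup>2 + (cmod (w$2))\<^sup>2)"
    unfolding cmod_power2 by (simp add: power2_eq_square algebra_simps)
  ultimately have "(cmod (v$3))\<^sup>2 * (cmod (w$3))\<^sup>2
      \<le> ((cmod (v$1))\<^sup>2 + (cmod (v$2))\<^sup>2) * ((cmod (w$1))\<^sup>2 + (cmod (w$2))\<^sup>2)"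
    unfolding norm_mult complex_mod_cnj power_mult_distrib
    using zero_le_power2[of "cmod (v$1 * w$2 - v$2 * w$1)"] by linarith
  moreover have n: "(cmod (z$1))\<^sup>2 + (cmod (z$2))\<^sup>2 < (cmod (z$3))\<^sup>2" if "Re (herm z z) < 0" for z
    using that unfolding cmod_power2 by (simp add: herm_def power2_eq_square)
  then have "((cmod (v$1))\<^sup>2 + (cmod (v$2))\<^sup>2) * ((cmod (w$1))\<^sup>2 + (cmod (w$2))\<^sup>2)
      < (cmod (v$3))\<^sup>2 * (cmod (w$3))\<^sup>2"
    using assms by (intro mult_strict_mono') auto
  ultimately show False by simp
qed

section \<open>Gram matrices and adapted frames\<close>

definition gram :: "cmat3 \<Rightarrow> cmat3" where
  "gram F = conj_transpose F ** N21 ** F"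

definition columns3 :: "complex^3 \<Rightarrow> complex^3 \<Rightarrow> complex^3 \<Rightarrow> cmat3" where
  "columns3 u v w = mat3 (u$1) (v$1) (w$1) (u$2) (v$2) (w$2) (u$3) (v$3) (w$3)"

lemma gram_columns3:
  "gram (columns3 u v w) =
   mat3 (herm u u) (herm v u) (herm w u) (herm u v) (herm v v) (herm w v) (herm u w) (herm v w) (herm w w)"
  by (simp add: gram_def columns3_def herm_def mat3_consts mult.commute)

lemma columns3_eigenvectors:
  assumes "x *v u = a *s u" "x *v v = b *s v" "x *v w = c *s w"
  shows "x ** columns3 u v w = columns3 u v w ** mat3 a 0 0 0 b 0 0 0 c"
proof -
  have "x$i$1 * z$1 + x$i$2 * z$2 + x$i$3 * z$3 = k * z$i" if "x *v z = k *s z" for i k z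
    using arg_cong[OF that, of "\<lambda>y. y$i"] by (simp add: mat3_vec)
  note * = this[OF assms(1)] this[OF assms(2)] this[OF assms(3)]
  have x: "x = mat3 (x$1$1) (x$1$2) (x$1$3) (x$2$1) (x$2$2) (x$2$3) (x$3$1) (x$3$2) (x$3$3)"
    by (rule mat3_expand)
  show ?thesis
    by (subst x) (auto simp: columns3_def * intro: mult.commute)
qed

lemma gram_det: "det (gram F) = - of_real ((cmod (det F))\<^sup>2)"
  by (simp add: gram_def det_mul det_conj_transpose mat3_consts complex_norm_square mult.commute del: of_real_power)

text \<open>The product is the determinant of a diagonal Gram matrix, which is minus the squared
  modulus of a determinant. This excludes three positive vectors.\<close>

lemma orthogonal_signature:
  assumes "herm u v = 0" "herm u w = 0" "herm v w = 0"
  shows "Re (herm u u) * Re (herm v v) * Re (herm w w) \<le> 0"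
proof -
  have 0: "herm v u = 0" "herm w u = 0" "herm w v = 0" using assms herm_eq_0_sym by blast+
  have "det (gram (columns3 u v w)) = herm u u * herm v v * herm w w"
    by (simp add: gram_columns3 assms 0)
  then have "of_real (Re (herm u u) * Re (herm v v) * Re (herm w w))
      = complex_of_real (- ((cmod (det (columns3 u v w)))\<^sup>2))"
    unfolding gram_det of_real_mult of_real_minus herm_self[symmetric] by simp
  then have "Re (herm u u) * Re (herm v v) * Re (herm w w) = - ((cmod (det (columns3 u v w)))\<^sup>2)"
    unfolding of_real_eq_iff .
  then show ?thesis by simp
qed

lemma conjugate_skew:
  assumes "x \<in> su21" "invertible F" "F ** y = x ** F"
  shows "trace y = 0" "conj_transpose y ** gram F + gram F ** y = 0"
proof -
  have y: "y = matrix_inv F ** x ** F"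
    using matrix_inv_cancel(6)[OF assms(2), of y] by (simp add: assms(3) matrix_mul_assoc)
  have "trace y = trace (F ** (matrix_inv F ** x))" unfolding y by (rule trace_mul_sym)
  then show "trace y = 0" using assms(1,2) by (simp add: matrix_inv_cancel su21_iff)
  have *: "conj_transpose y ** conj_transpose F = conj_transpose F ** conj_transpose x"
    using arg_cong[OF assms(3), of conj_transpose] by (simp add: conj_transpose_mult)
  have "conj_transpose y ** gram F + gram F ** y
      = conj_transpose y ** conj_transpose F ** N21 ** F + conj_transpose F ** N21 ** (F ** y)"
    by (simp add: gram_def matrix_mul_assoc)
  also have "\<dots> = conj_transpose F ** (conj_transpose x ** N21 + N21 ** x) ** F"
    unfolding * assms(3) by (simp add: matrix_mul_assoc matrix_add_rdistrib matrix_add_ldistrib)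
  also have "\<dots> = 0"
    using assms(1) by (simp add: su21_iff)
  finally show "conj_transpose y ** gram F + gram F ** y = 0" .
qed

lemma isotropic_frame:
  assumes "v \<noteq> 0" "herm v v = 0"
  shows "\<exists>F k. gram F = J21 \<and> k \<noteq> 0 \<and> F$1$1 = k * v$1 \<and> F$2$1 = k * v$2 \<and> F$3$1 = k * v$3"
proof -
  have h: "v$1 * cnj (v$1) + v$2 * cnj (v$2) = v$3 * cnj (v$3)"
    using assms(2) by (simp add: herm_def)
  have v3: "v$3 \<noteq> 0"
  proof
    assume "v$3 = 0"
    with arg_cong[OF h, of Re]
    have "Re (v$1) * Re (v$1) + Im (v$1) * Im (v$1) + (Re (v$2) * Re (v$2) + Im (v$2) * Im (v$2)) = 0"
      by simp
    then have "(cmod (v$1))\<^sup>2 + (cmod (v$2))\<^sup>2 = 0" by (simp only: cmod_power2) (simp only: power2_eq_square)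
    then have "cmod (v$1) = 0 \<and> cmod (v$2) = 0" unfolding sum_power2_eq_zero_iff .
    then have "v = 0" using \<open>v$3 = 0\<close> by (simp add: vec3_eq_iff)
    with assms(1) show False by blast
  qed
  define a b where "a = v$1 / v$3" and "b = v$2 / v$3"
  have "a * cnj a + b * cnj b = 1"
    using h v3 by (simp add: a_def b_def add_divide_distrib[symmetric])
  then have ab: "cnj a * a = 1 - cnj b * b" by (simp add: algebra_simps)
  \<comment> \<open>Scaled to (a, b, 1) with |a|^2 + |b|^2 = 1, the vector has the isotropic partner
    (a, b, -1) / 2; the middle column is a unit vector orthogonal to both.\<close>
  have "gram (mat3 a (- cnj b) (a / 2) b (cnj a) (b / 2) 1 0 (- 1 / 2)) = J21"
    by (simp add: gram_def mat3_consts J21_def ab mult.commute[of a "cnj a"] mult.commute[of b "cnj b"])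
      (simp add: field_simps)
  with v3 show ?thesis
    by (intro exI[of _ "mat3 a (- cnj b) (a / 2) b (cnj a) (b / 2) 1 0 (- 1 / 2)"] exI[of _ "1 / v$3"])
      (simp add: a_def b_def)
qed

lemma borel_mat_exists:
  assumes "trace y = 0" "conj_transpose y ** J21 + J21 ** y = 0" "y$2$1 = 0" "y$3$1 = 0"
  shows "\<exists>r s z t. y = borel_mat r s z t"
proof -
  obtain a b c d e f g h i where y: "y = mat3 a b c d e f g h i"
    using mat3_expand by blast
  have dg: "d = 0" "g = 0" using assms(3,4) by (simp_all add: y)
  have *: "cnj d + h = 0" "cnj a + i = 0" "cnj e + e = 0" "cnj b + f = 0" "cnj c + c = 0" "a + e + i = 0"
    using assms(1,2) by (simp_all add: y J21_def mat3_consts)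
  have "h = 0" using *(1) dg by simp
  moreover have i: "i = Complex (- Re a) (Im a)" using *(2) by (simp add: complex_eq_iff)
  moreover have "e = Complex 0 (- 2 * Im a)"
    using *(3,6) i by (simp add: complex_eq_iff)
  moreover have "f = - cnj b" using *(4) by (metis add.commute eq_neg_iff_add_eq_0)
  moreover have "c = Complex 0 (Im c)" using *(5) by (simp add: complex_eq_iff)
  ultimately have "y = borel_mat (Re a) (Im a) b (Im c)"
    using dg by (simp add: y borel_mat_def)
  then show ?thesis by blast
qed

lemma J_equiv_sym:
  assumes "J_equiv u v"
  shows "J_equiv v u"
proof -
  obtain T where T: "conj_transpose T ** J21 ** T = J21" "SU21_act T u = v"
    using assms unfolding J_equiv_def by blast
  have inv: "invertible T" using T(1) invertible_of_form det_J21 by blast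
  let ?S = "matrix_inv T"
  have "conj_transpose ?S ** conj_transpose T = mat 1"
    using arg_cong[OF matrix_inv_mult(1)[OF inv], of conj_transpose]
    by (simp add: conj_transpose_mult) (simp add: mat3_consts)
  then have "conj_transpose ?S ** (conj_transpose T ** J21 ** T) ** ?S = J21"
    using inv by (simp add: matrix_mul_assoc matrix_inv_cancel)
  then have "conj_transpose ?S ** J21 ** ?S = J21" by (simp add: T(1))
  moreover have "SU21_act ?S v = u" using T(2) SU21_act_inverse(2)[OF inv] by blast
  ultimately show ?thesis unfolding J_equiv_def by blast
qed

lemma isotropic_classification:
  assumes u: "plane_basis u x y" "lie_bracket x y \<in> u" and xy: "x \<in> su21" "y \<in> su21"
    and v: "v \<noteq> 0" "herm v v = 0" "x *v v = a *s v" "y *v v = b *s v"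
  shows "\<exists>F e. gram F = J21 \<and> e \<noteq> V23 \<and> u = SU21_act F (model e)"
proof -
  obtain F k where F: "gram F = J21" and k: "k \<noteq> 0" "F$1$1 = k * v$1" "F$2$1 = k * v$2" "F$3$1 = k * v$3"
    using isotropic_frame v by blast
  have inv: "invertible F" using F det_J21 invertible_of_form unfolding gram_def by blast
  define S where "S = matrix_inv F"
  have invS: "invertible S"
    using matrix_inv_mult[OF inv] unfolding S_def invertible_def by blast
  have *: "\<exists>r s z t. S ** x ** F = borel_mat r s z t" if x: "x \<in> su21" "x *v v = a *s v" for x a
  proof (rule borel_mat_exists)
    have Fy: "F ** (S ** x ** F) = x ** F"
      using inv by (simp add: S_def matrix_mul_assoc matrix_inv_cancel)
    show "trace (S ** x ** F) = 0" "conj_transpose (S ** x ** F) ** J21 + J21 ** (S ** x ** F) = 0"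
      using conjugate_skew[OF x(1) inv Fy] F by auto
    have Fe: "F *v axis 1 1 = k *s v"
      by (simp add: vec3_eq_iff mat3_vec k axis_def)
    have "(S ** x ** F) *v axis 1 1 = S *v (x *v (F *v axis 1 1))"
      by (simp add: matrix_vector_mul_assoc matrix_mul_assoc)
    also have "\<dots> = a *s (S *v (F *v axis 1 1))"
      unfolding Fe by (simp add: vector_scalar_commute x vector_smult_assoc mult.commute)
    also have "\<dots> = a *s axis 1 1"
      using inv by (simp add: S_def matrix_vector_mul_assoc matrix_inv_cancel)
    finally show "(S ** x ** F)$2$1 = 0" "(S ** x ** F)$3$1 = 0"
      by (simp_all add: vec3_eq_iff mat3_vec axis_def)
  qed
  obtain r s z t r' s' z' t' where x': "S ** x ** F = borel_mat r s z t"
    and y': "S ** y ** F = borel_mat r' s' z' t'" using * xy v by meson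
  have "S ** x = borel_mat r s z t ** S" "S ** y = borel_mat r' s' z' t' ** S"
    using inv unfolding x'[symmetric] y'[symmetric] S_def by (simp_all add: matrix_inv_cancel)
  note act_plane_basis[OF u(1) invS this] act_bracket[OF u(2) invS this]
  from borel_classification[OF this] obtain e where e: "e \<noteq> V23" "J_equiv (SU21_act S u) (model e)"
    by blast
  then obtain T where T: "conj_transpose T ** J21 ** T = J21" "SU21_act T (model e) = SU21_act S u"
    using J_equiv_sym unfolding J_equiv_def by blast
  \<comment> \<open>The normalizing transformation is absorbed into the frame, whose Gram matrix it
    preserves.\<close>
  have "gram (F ** T) = conj_transpose T ** gram F ** T"
    by (simp add: gram_def conj_transpose_mult matrix_mul_assoc)
  then have "gram (F ** T) = J21" using T F by simp
  moreover have "SU21_act (F ** T) (model e) = u"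
    using SU21_act_act[OF inv, of T "model e"] invertible_of_form[OF T(1) det_J21] T(2)
      SU21_act_inverse(1)[OF inv] unfolding S_def by simp
  ultimately show ?thesis using e(1) by blast
qed

section \<open>Subalgebras without an isotropic common eigenvector\<close>

lemma plane_basis_imp_span:
  assumes "plane_basis u x y"
  shows "u = span {x, y}" "dim u = 2"
proof -
  have *: "p = 0 \<and> q = 0" if "p *\<^sub>R x + q *\<^sub>R y = 0" for p q
    using assms that unfolding plane_basis_def by blast
  show u: "u = span {x, y}"
    using plane_basis_span(1)[OF *] assms unfolding plane_basis_def by blast
  show "dim u = 2" unfolding u by (rule plane_basis_span(2)[OF *])
qed

lemma plane_eq_of_mem:
  assumes "plane_basis u x y" "plane_basis v x' y'" "x \<in> v" "y \<in> v"
  shows "u = v"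
proof -
  note u = plane_basis_imp_span[OF assms(1)] and v = plane_basis_imp_span[OF assms(2)]
  have "u \<subseteq> v" unfolding u(1) using assms(3,4) unfolding v(1) by (simp add: span_minimal)
  then show ?thesis
    using subspace_dim_equal[of u v] u v by (metis order_refl subspace_span)
qed

lemma plane_basis_model_V23:
  "plane_basis (model V23) (mat3 \<i> 0 0 0 0 0 0 0 (- \<i>)) (mat3 0 0 0 0 \<i> 0 0 0 (- \<i>))"
  by (auto simp: plane_basis_def mat3_consts algebra_simps)

text \<open>In the eigenframe both generators are diagonal, and skewness with trace zero makes their
  entries imaginary with sum zero. Such matrices form a plane, so inclusion is already
  equality.\<close>

lemma orthonormal_classification:
  assumes u: "plane_basis u x y" and xy: "x \<in> su21" "y \<in> su21"
    and v: "herm v1 v2 = 0" "herm v1 v3 = 0" "herm v2 v3 = 0"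
      "herm v1 v1 = 1" "herm v2 v2 = 1" "herm v3 v3 = -1"
    and ev: "\<And>v. v \<in> {v1, v2, v3} \<Longrightarrow> (\<exists>a. x *v v = a *s v) \<and> (\<exists>b. y *v v = b *s v)"
  shows "\<exists>F. gram F = N21 \<and> u = SU21_act F (model V23)"
proof -
  define F where "F = columns3 v1 v2 v3"
  have 0: "herm v2 v1 = 0" "herm v3 v1 = 0" "herm v3 v2 = 0" using v herm_eq_0_sym by blast+
  have F: "gram F = N21" by (simp add: F_def gram_columns3 v 0 mat3_consts)
  have "det N21 \<noteq> 0" by (simp add: mat3_consts)
  then have inv: "invertible F" using F invertible_of_form unfolding gram_def by blast
  define S where "S = matrix_inv F"
  have invS: "invertible S"
    using matrix_inv_mult[OF inv] unfolding S_def invertible_def by blast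
  have *: "\<exists>z\<in>model V23. S ** x = z ** S"
    if x: "x \<in> su21" "\<exists>a. x *v v1 = a *s v1" "\<exists>a. x *v v2 = a *s v2" "\<exists>a. x *v v3 = a *s v3" for x
  proof -
    obtain a b c where "x *v v1 = a *s v1" "x *v v2 = b *s v2" "x *v v3 = c *s v3" using x by blast
    then have xF: "F ** mat3 a 0 0 0 b 0 0 0 c = x ** F"
      unfolding F_def by (rule columns3_eigenvectors[symmetric])
    from conjugate_skew[OF x(1) inv xF] have "mat3 a 0 0 0 b 0 0 0 c =
        mat3 (\<i> * of_real (Im a)) 0 0 0 (\<i> * of_real (Im b)) 0 0 0 (- \<i> * (of_real (Im a) + of_real (Im b)))"
      unfolding F by (auto simp: mat3_consts complex_eq_iff)
    then have "mat3 a 0 0 0 b 0 0 0 c \<in> model V23" by fastforce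
    moreover have "S ** x = mat3 a 0 0 0 b 0 0 0 c ** S"
      using xF inv by (metis S_def matrix_inv_cancel(3,6) matrix_mul_assoc)
    ultimately show ?thesis by blast
  qed
  obtain x' y' where x': "x' \<in> model V23" "S ** x = x' ** S" and y': "y' \<in> model V23" "S ** y = y' ** S"
    using *[OF xy(1)] *[OF xy(2)] ev by blast
  have "SU21_act S u = model V23"
    by (rule plane_eq_of_mem[OF act_plane_basis[OF u invS x'(2) y'(2)] plane_basis_model_V23 x'(1) y'(1)])
  then have "u = SU21_act F (model V23)"
    using SU21_act_inverse(1)[OF inv] unfolding S_def by metis
  with F show ?thesis by blast
qed

lemma orthogonal_classification:
  assumes u: "plane_basis u x y" and xy: "x \<in> su21" "y \<in> su21"
    and v: "herm v1 v2 = 0" "herm v1 v3 = 0" "herm v2 v3 = 0"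
      "Re (herm v1 v1) > 0" "Re (herm v2 v2) > 0" "Re (herm v3 v3) < 0"
    and ev: "\<And>v. v \<in> {v1, v2, v3} \<Longrightarrow> (\<exists>a. x *v v = a *s v) \<and> (\<exists>b. y *v v = b *s v)"
  shows "\<exists>F. gram F = N21 \<and> u = SU21_act F (model V23)"
proof -
  define nrm where "nrm v = complex_of_real (1 / sqrt \<bar>Re (herm v v)\<bar>) *s v" for v
  have nn: "herm (nrm v) (nrm v) = of_real (sgn (Re (herm v v)))" for v
  proof -
    have "herm (nrm v) (nrm v) = of_real ((1 / sqrt \<bar>Re (herm v v)\<bar>) * ((1 / sqrt \<bar>Re (herm v v)\<bar>) * Re (herm v v)))"
      unfolding nrm_def herm_linear complex_cnj_complex_of_real of_real_mult herm_self[symmetric] ..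
    also have "(1 / sqrt \<bar>Re (herm v v)\<bar>) * ((1 / sqrt \<bar>Re (herm v v)\<bar>) * Re (herm v v)) = sgn (Re (herm v v))"
      by (auto simp: sgn_if)
    finally show ?thesis .
  qed
  have no: "herm (nrm v) (nrm w) = 0" if "herm v w = 0" for v w
    using that by (simp add: nrm_def herm_linear)
  have ne: "\<exists>a. x *v nrm v = a *s nrm v" if "\<exists>a. x *v v = a *s v" for x v
  proof -
    obtain a where "x *v v = a *s v" using \<open>\<exists>a. x *v v = a *s v\<close> by blast
    then have "x *v nrm v = a *s nrm v"
      by (simp add: nrm_def vector_scalar_commute vector_smult_assoc mult.commute)
    then show ?thesis by blast
  qed
  show ?thesis
    by (rule orthonormal_classification[OF u xy, of "nrm v1" "nrm v2" "nrm v3"])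
      (use v ev in \<open>auto simp: nn no intro!: ne\<close>)
qed

definition frame_form :: "entry \<Rightarrow> cmat3" where
  "frame_form e = (if e = V23 then N21 else J21)"

lemma subalgebra_frame:
  assumes "lie_subalgebra_su21 u" "dim u = 2"
  shows "\<exists>F e. gram F = frame_form e \<and> u = SU21_act F (model e)"
proof -
  have sub: "u \<subseteq> su21" "subspace u" "\<And>x y. x \<in> u \<Longrightarrow> y \<in> u \<Longrightarrow> lie_bracket x y \<in> u"
    using assms(1) unfolding lie_subalgebra_su21_def by auto
  obtain x0 y0 where "plane_basis u x0 y0" using plane_basis_exists sub assms(2) by blast
  then obtain x y where u: "plane_basis u x y" and br: "lie_bracket x y = 0 \<or> lie_bracket x y = y"
    using plane_basis_lie_normal_form plane_basis_mem sub(3) by blast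
  have xy: "x \<in> u" "y \<in> u" using plane_basis_mem[OF u] by auto
  then have xs: "x \<in> su21" "y \<in> su21" using sub by auto
  define ev where "ev v \<longleftrightarrow> (\<exists>a. x *v v = a *s v) \<and> (\<exists>b. y *v v = b *s v)" for v
  show ?thesis
  proof (cases "\<exists>v. v \<noteq> 0 \<and> ev v \<and> herm v v = 0")
    case True
    then show ?thesis
      using isotropic_classification[OF u sub(3)[OF xy] xs] unfolding ev_def frame_form_def by metis
  next
    case False
    then have nz: "Re (herm v v) \<noteq> 0" if "v \<noteq> 0" "ev v" for v
      using that herm_self[of v] by auto
    \<comment> \<open>By \<open>su21_skew\<close> the orthogonal complement of common eigenvectors
      is invariant, so it contains another one. Taking v = w gives the complement of a single
      vector.\<close>
    have perp: "\<exists>z. z \<noteq> 0 \<and> ev z \<and> herm z v = 0 \<and> herm z w = 0" if "ev v" "ev w" for v w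
    proof -
      let ?V = "{z. herm z v = 0 \<and> herm z w = 0}"
      have V: "vec.subspace ?V" by (auto simp: vec.subspace_def herm_linear)
      obtain z where z: "z \<in> ?V" "z \<noteq> 0" using orthogonal_vector_exists by blast
      have "herm (x *v z) v = 0" if "x \<in> su21" "\<exists>a. x *v v = a *s v" "herm z v = 0" for x z v
        using that by (auto simp: su21_skew herm_linear)
      then have "x *v z \<in> ?V" "y *v z \<in> ?V" if "z \<in> ?V" for z
        using xs \<open>ev v\<close> \<open>ev w\<close> that unfolding ev_def by auto
      from common_eigenvector[OF V z this br] show ?thesis unfolding ev_def by auto
    qed
    obtain v where v: "v \<noteq> 0" "ev v"
      using common_eigenvector[of UNIV "axis 1 1" x y] br unfolding ev_def
      by (auto simp: vec.subspace_UNIV axis_eq_0_iff)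
    obtain w where w: "w \<noteq> 0" "ev w" "herm w v = 0" using perp v by blast
    obtain z where z: "z \<noteq> 0" "ev z" "herm z v = 0" "herm z w = 0" using perp v w by blast
    have h: "herm v w = 0" "herm v z = 0" "herm w z = 0"
      using w z herm_eq_0_sym by blast+
    have concl: "\<exists>F. gram F = N21 \<and> u = SU21_act F (model V23)"
      if "herm a b = 0" "herm a c = 0" "herm b c = 0" "Re (herm a a) > 0" "Re (herm b b) > 0"
        "Re (herm c c) < 0" "ev a" "ev b" "ev c" for a b c
      by (rule orthogonal_classification[OF u xs that(1-6)]) (use that in \<open>auto simp: ev_def\<close>)
    \<comment> \<open>At most one of the three norms is negative and not all are positive, so
      exactly one is negative; the cases only relabel the vectors.\<close>
    have prod: "Re (herm v v) * Re (herm w w) * Re (herm z z) \<le> 0"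
      using orthogonal_signature h by blast
    have neg: "\<not> (Re (herm v v) < 0 \<and> Re (herm w w) < 0)" "\<not> (Re (herm v v) < 0 \<and> Re (herm z z) < 0)"
      "\<not> (Re (herm w w) < 0 \<and> Re (herm z z) < 0)"
      using herm_negative_orthogonal h by blast+
    have "\<not> (Re (herm v v) > 0 \<and> Re (herm w w) > 0 \<and> Re (herm z z) > 0)"
      using prod by (meson mult_pos_pos not_le)
    then consider "Re (herm v v) > 0" "Re (herm w w) > 0" "Re (herm z z) < 0"
      | "Re (herm v v) > 0" "Re (herm w w) < 0" "Re (herm z z) > 0"
      | "Re (herm v v) < 0" "Re (herm w w) > 0" "Re (herm z z) > 0"
      using nz v w z neg by (meson not_less_iff_gr_or_eq)
    then have "\<exists>F. gram F = N21 \<and> u = SU21_act F (model V23)"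
    proof cases
      case 1
      show ?thesis by (rule concl[of v w z]) (use 1 h v w z in auto)
    next
      case 2
      show ?thesis by (rule concl[of v z w]) (use 2 h v w z in auto)
    next
      case 3
      show ?thesis by (rule concl[of w z v]) (use 3 h v w z in auto)
    qed
    then show ?thesis unfolding frame_form_def by metis
  qed
qed

section \<open>The entries of the list in normal form\<close>

text \<open>The first column of either frame spans an isotropic line fixed by the algebras concerned; the
  other columns complete it so that the Gram matrix is \<open>J21\<close>. In \<open>frame_a\<close> the phase of the
  second column makes the superdiagonal entry of \<open>A3 + A4 - A7 + A8\<close> real.\<close>

definition frame_a :: cmat3 where
  "frame_a = cscale (of_real (1 / sqrt 2)) (mat3 1 0 1 0 (1 - \<i>) 0 (- 1) 0 1)"

definition frame_b :: cmat3 where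
  "frame_b = cscale (1 / 2) (mat3 1 (of_real (sqrt 2)) 1 (- 1) (of_real (sqrt 2)) (- 1)
     (- of_real (sqrt 2)) 0 (of_real (sqrt 2)))"

text \<open>The fixed isotropic line is spanned by (1, 0, -1) for \<open>V21\<close> and
  \<open>V25\<close>, and by (1, -1, -sqrt 2) for \<open>V22\<close>, \<open>V24\<close> and
  \<open>V26\<close>.\<close>

definition entry_frame :: "entry \<Rightarrow> cmat3" where
  "entry_frame e = (if e = V23 then mat 1 else if e = V21 \<or> e = V25 then frame_a else frame_b)"

lemma of_real_sqrt2_sq: "complex_of_real (sqrt 2) * complex_of_real (sqrt 2) = 2"
  "complex_of_real (sqrt 2) * (complex_of_real (sqrt 2) * z) = 2 * z"
  unfolding of_real_mult[symmetric] mult.assoc[symmetric] by simp_all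

lemma gram_cscale: "gram (cscale c x) = cscale (cnj c * c) (gram x)"
  by (simp add: gram_def cscale_simps cscale_mult mult.commute)

lemma gram_frames: "gram frame_a = J21" "gram frame_b = J21"
proof -
  have "gram (mat3 1 0 1 0 (1 - \<i>) 0 (- 1) 0 1) = cscale 2 J21"
    by (simp add: gram_def J21_def mat3_consts algebra_simps)
  moreover have "cnj (complex_of_real (1 / sqrt 2)) * of_real (1 / sqrt 2) * 2 = 1"
    unfolding complex_cnj_complex_of_real by (simp flip: of_real_mult)
  ultimately show "gram frame_a = J21" unfolding frame_a_def gram_cscale by (simp add: cscale_simps)
  show "gram frame_b = J21" unfolding frame_b_def gram_cscale
    by (simp add: gram_def J21_def mat3_consts of_real_sqrt2_sq)
qed

lemma gram_entry_frame: "gram (entry_frame e) = frame_form e"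
  by (simp add: entry_frame_def frame_form_def gram_frames) (simp add: gram_def mat3_consts)

lemma invertible_of_gram: "gram F = frame_form e \<Longrightarrow> invertible F"
  unfolding gram_def by (rule invertible_of_form, assumption)
    (simp add: frame_form_def det_J21, simp add: mat3_consts)

lemma frame_a_intertwines:
  "frame_a ** borel_mat 0 0 2 0 = (A3 + A4 - A7 + A8) ** frame_a"
  "frame_a ** borel_mat 0 0 0 2 = (A1 + A2 + A6) ** frame_a"
  "frame_a ** borel_mat (- 1) 0 0 0 = A5 ** frame_a"
  unfolding frame_a_def cscale_mult
  by (simp_all add: borel_mat_def mat3_consts Complex_eq algebra_simps)

text \<open>This reveals the roles of the generators: central, compact torus, split torus, and a
  mixed torus element of slope -2\<mu>.\<close>

lemma frame_b_intertwines:
  "frame_b ** borel_mat 0 0 0 4 = (A1 + 2 *\<^sub>R A2 - A4 + sqrt 2 *\<^sub>R A6 - sqrt 2 *\<^sub>R A8) ** frame_b"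
  "frame_b ** borel_mat 0 (- 2) 0 0 = (A1 + 2 *\<^sub>R A2 + 3 *\<^sub>R A4) ** frame_b"
  "frame_b ** borel_mat (- sqrt 2) 0 0 0 = (A5 - A7) ** frame_b"
  "frame_b ** borel_mat 2 (- 4 * \<mu>) 0 0 =
    ((2 * \<mu>) *\<^sub>R A1 + (4 * \<mu>) *\<^sub>R A2 + (6 * \<mu>) *\<^sub>R A4 - sqrt 2 *\<^sub>R A5 + sqrt 2 *\<^sub>R A7) ** frame_b"
  unfolding frame_b_def cscale_mult
  by (simp_all add: borel_mat_def mat3_consts Complex_eq of_real_sqrt2_sq algebra_simps)

lemma plane_basis_entry_models:
  "plane_basis (model V21) (borel_mat 0 0 2 0) (borel_mat 0 0 0 2)"
  "plane_basis (model V22) (borel_mat 0 0 0 4) (borel_mat 0 (- 2) 0 0)"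
  "plane_basis (model V24) (borel_mat (- sqrt 2) 0 0 0) (borel_mat 0 (- 2) 0 0)"
  "plane_basis (model V25) (borel_mat 0 0 2 0) (borel_mat (- 1) 0 0 0)"
  "plane_basis (model (V26 \<mu>)) (borel_mat 0 0 0 4) (borel_mat 2 (- 4 * \<mu>) 0 0)"
proof -
  note b = plane_basis_model
  show "plane_basis (model V21) (borel_mat 0 0 2 0) (borel_mat 0 0 0 2)"
    using plane_basis_scale2[OF plane_basis_scale[OF b(1), of 2], of 2] by (simp add: borel_linear)
  show "plane_basis (model V22) (borel_mat 0 0 0 4) (borel_mat 0 (- 2) 0 0)"
    using plane_basis_swap[OF plane_basis_scale2[OF plane_basis_scale[OF b(2), of "- 2"], of 4]]
    by (simp add: borel_linear del: scaleR_minus_left)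
  show "plane_basis (model V24) (borel_mat (- sqrt 2) 0 0 0) (borel_mat 0 (- 2) 0 0)"
    using plane_basis_scale2[OF plane_basis_scale[OF b(3), of "- sqrt 2"], of "- 2"]
    by (simp add: borel_linear del: scaleR_minus_left)
  show "plane_basis (model V25) (borel_mat 0 0 2 0) (borel_mat (- 1) 0 0 0)"
    using plane_basis_swap[OF plane_basis_scale2[OF plane_basis_scale[OF b(4), of "- 1"], of 2]]
    by (simp add: borel_linear del: scaleR_minus_left)
  show "plane_basis (model (V26 \<mu>)) (borel_mat 0 0 0 4) (borel_mat 2 (- 4 * \<mu>) 0 0)"
    using plane_basis_swap[OF plane_basis_scale2[OF plane_basis_scale[OF b(5), of 2], of 4]]
    by (simp add: borel_linear del: scaleR_minus_left)
qed

lemma entry_via_frame: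
  assumes "plane_basis (model e) x y" "entry_frame e ** x = x' ** entry_frame e"
    "entry_frame e ** y = y' ** entry_frame e" "entry_algebra e = span {x', y'}"
    "lie_bracket x y \<in> model e"
  shows "entry_algebra e = SU21_act (entry_frame e) (model e) \<and> dim (entry_algebra e) = 2 \<and>
    plane_basis (entry_algebra e) x' y' \<and> lie_bracket x' y' \<in> entry_algebra e"
proof -
  have inv: "invertible (entry_frame e)" using gram_entry_frame invertible_of_gram by blast
  note p = act_plane_basis[OF assms(1) inv assms(2,3)]
  show ?thesis
    using p plane_basis_imp_span[OF p] act_bracket[OF assms(5) inv assms(2,3)] assms(4) by simp
qed

lemma conj_transpose_linear:
  "conj_transpose (x + y) = conj_transpose x + conj_transpose y"
  "conj_transpose (p *\<^sub>R x) = p *\<^sub>R conj_transpose x"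
  by (simp_all add: vec_eq_iff conj_transpose_def)

lemma lie_subalgebraI:
  assumes u: "plane_basis u x y" and br: "lie_bracket x y \<in> u" and xy: "x \<in> su21" "y \<in> su21"
  shows "lie_subalgebra_su21 u"
proof -
  have sub: "subspace u" unfolding plane_basis_imp_span(1)[OF u] by (rule subspace_span)
  have lin: "p *\<^sub>R x + q *\<^sub>R y \<in> su21" for p q
  proof -
    have "conj_transpose (p *\<^sub>R x + q *\<^sub>R y) ** N21 + N21 ** (p *\<^sub>R x + q *\<^sub>R y)
      = p *\<^sub>R (conj_transpose x ** N21 + N21 ** x) + q *\<^sub>R (conj_transpose y ** N21 + N21 ** y)"
      by (simp add: conj_transpose_linear matrix_add_ldistrib matrix_add_rdistrib matrix_scalar_ac
          scaleR_right_distrib flip: scalar_matrix_assoc)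
    moreover have "trace (p *\<^sub>R x + q *\<^sub>R y) = p *\<^sub>R trace x + q *\<^sub>R trace y"
      by (simp add: trace_def sum_3 scaleR_right_distrib)
    ultimately show ?thesis using xy by (simp add: su21_iff)
  qed
  moreover have "lie_bracket (p *\<^sub>R x + q *\<^sub>R y) (p' *\<^sub>R x + q' *\<^sub>R y) \<in> u" for p q p' q'
  proof -
    have "lie_bracket (p *\<^sub>R x + q *\<^sub>R y) (p' *\<^sub>R x + q' *\<^sub>R y) = (p * q' - q * p') *\<^sub>R lie_bracket x y"
      by (simp add: lie_bracket_simps lie_bracket_anti[of y x] algebra_simps)
    then show ?thesis using subspace_scale[OF sub br] by simp
  qed
  ultimately show ?thesis
    unfolding lie_subalgebra_su21_def using sub u unfolding plane_basis_def by auto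
qed

lemma generators_su21:
  "A3 + A4 - A7 + A8 \<in> su21" "A1 + A2 + A6 \<in> su21" "A5 \<in> su21" "A1 \<in> su21" "A2 \<in> su21"
  "A1 + 2 *\<^sub>R A2 - A4 + sqrt 2 *\<^sub>R A6 - sqrt 2 *\<^sub>R A8 \<in> su21" "A1 + 2 *\<^sub>R A2 + 3 *\<^sub>R A4 \<in> su21"
  "A5 - A7 \<in> su21"
  "(2 * \<mu>) *\<^sub>R A1 + (4 * \<mu>) *\<^sub>R A2 + (6 * \<mu>) *\<^sub>R A4 - sqrt 2 *\<^sub>R A5 + sqrt 2 *\<^sub>R A7 \<in> su21"
  unfolding su21_iff by (simp_all add: mat3_consts)

lemma plane_basis_entry_V23: "plane_basis (model V23) A1 A2"
proof -
  have "plane_basis (model V23) (mat3 \<i> 0 0 0 0 0 0 0 (- \<i>) + (- 1) *\<^sub>R mat3 0 0 0 0 \<i> 0 0 0 (- \<i>))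
      (mat3 0 0 0 0 \<i> 0 0 0 (- \<i>))"
    by (rule plane_basis_swap[OF plane_basis_shear[OF plane_basis_swap[OF plane_basis_model_V23]]])
  then show ?thesis by (simp add: mat3_consts del: scaleR_minus_left model.simps)
qed

lemma entry_properties:
  "entry_algebra e = SU21_act (entry_frame e) (model e) \<and> dim (entry_algebra e) = 2 \<and>
   lie_subalgebra_su21 (entry_algebra e)"
proof (cases e)
  case V21
  \<comment> \<open>The entry is written \<open>of_real 0\<close> so that the result is literally an
    instance of the comprehension defining the model.\<close>
  have "lie_bracket (borel_mat 0 0 2 0) (borel_mat 0 0 0 2) = borel_mat 0 0 (of_real 0) 0"
    by (simp add: borel_bracket Complex_eq)
  then have "lie_bracket (borel_mat 0 0 2 0) (borel_mat 0 0 0 2) \<in> model V21"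
    unfolding model.simps by blast
  note * = entry_via_frame[OF plane_basis_entry_models(1) _ _ _ this]
  have "entry_frame V21 = frame_a" by (simp add: entry_frame_def)
  note * = *[unfolded this, OF frame_a_intertwines(1,2) entry_algebra.simps(1)]
  show ?thesis unfolding V21 using * lie_subalgebraI generators_su21 \<open>entry_frame V21 = _\<close> by metis
next
  case V22
  have "lie_bracket (borel_mat 0 0 0 4) (borel_mat 0 (- 2) 0 0) \<in> model V22"
    by (auto simp: borel_bracket borel_linear)
  note * = entry_via_frame[OF plane_basis_entry_models(2) _ _ _ this]
  have "entry_frame V22 = frame_b" by (simp add: entry_frame_def)
  note * = *[unfolded this, OF frame_b_intertwines(1,2) entry_algebra.simps(2)]
  show ?thesis unfolding V22 using * lie_subalgebraI generators_su21 \<open>entry_frame V22 = _\<close> by metis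
next
  case V23
  have "lie_bracket A1 A2 = mat3 (\<i> * of_real 0) 0 0 0 (\<i> * of_real 0) 0 0 0 (- \<i> * (of_real 0 + of_real 0))"
    by (simp add: lie_bracket_def mat3_consts)
  then have "lie_bracket A1 A2 \<in> model V23" unfolding model.simps by blast
  note * = entry_via_frame[OF plane_basis_entry_V23 _ _ _ this]
  have "entry_frame V23 = mat 1" by (simp add: entry_frame_def)
  note * = *[unfolded this, OF _ _ entry_algebra.simps(3), simplified matrix_mul_lid matrix_mul_rid]
  show ?thesis unfolding V23 using * lie_subalgebraI generators_su21 \<open>entry_frame V23 = _\<close> by metis
next
  case V24
  have "lie_bracket (borel_mat (- sqrt 2) 0 0 0) (borel_mat 0 (- 2) 0 0) \<in> model V24"
    by (auto simp: borel_bracket borel_linear)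
  note * = entry_via_frame[OF plane_basis_entry_models(3) _ _ _ this]
  have "entry_frame V24 = frame_b" by (simp add: entry_frame_def)
  note * = *[unfolded this, OF frame_b_intertwines(3,2) entry_algebra.simps(4)]
  show ?thesis unfolding V24 using * lie_subalgebraI generators_su21 \<open>entry_frame V24 = _\<close> by metis
next
  case V25
  have "lie_bracket (borel_mat 0 0 2 0) (borel_mat (- 1) 0 0 0) = borel_mat 0 0 (of_real 2) 0"
    by (simp add: borel_bracket Complex_eq)
  then have "lie_bracket (borel_mat 0 0 2 0) (borel_mat (- 1) 0 0 0) \<in> model V25"
    unfolding model.simps by blast
  note * = entry_via_frame[OF plane_basis_entry_models(4) _ _ _ this]
  have "entry_frame V25 = frame_a" by (simp add: entry_frame_def)
  note * = *[unfolded this, OF frame_a_intertwines(1,3) entry_algebra.simps(5)]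
  show ?thesis unfolding V25 using * lie_subalgebraI generators_su21 \<open>entry_frame V25 = _\<close> by metis
next
  case (V26 \<mu>)
  have "lie_bracket (borel_mat 0 0 0 4) (borel_mat 2 (- 4 * \<mu>) 0 0) \<in> model (V26 \<mu>)"
    by (auto simp: borel_bracket borel_linear)
  note * = entry_via_frame[OF plane_basis_entry_models(5) _ _ _ this]
  have "entry_frame (V26 \<mu>) = frame_b" by (simp add: entry_frame_def)
  note * = *[unfolded this, OF frame_b_intertwines(1,4) entry_algebra.simps(6)]
  show ?thesis unfolding V26 using * lie_subalgebraI generators_su21 \<open>entry_frame (V26 \<mu>) = _\<close> by metis
qed

text \<open>Conjugacy under all of GL(3,C). It forgets the form, so models belonging to different
  Gram matrices can be compared, and it is still fine enough to separate all entries.\<close>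

definition similar :: "cmat3 set \<Rightarrow> cmat3 set \<Rightarrow> bool" where
  "similar u v \<longleftrightarrow> (\<exists>T. invertible T \<and> SU21_act T u = v)"

lemma similar_sym:
  assumes "similar u v"
  shows "similar v u"
proof -
  obtain T where T: "invertible T" "SU21_act T u = v" using assms unfolding similar_def by blast
  have "invertible (matrix_inv T)" using matrix_inv_mult[OF T(1)] unfolding invertible_def by blast
  moreover have "SU21_act (matrix_inv T) v = u" using SU21_act_inverse(2)[OF T(1)] T(2) by blast
  ultimately show ?thesis unfolding similar_def by blast
qed

lemma similar_trans:
  assumes "similar u v" "similar v w"
  shows "similar u w"
proof -
  obtain S T where S: "invertible S" "SU21_act S u = v" and T: "invertible T" "SU21_act T v = w"
    using assms unfolding similar_def by blast
  have "SU21_act (T ** S) u = w" using SU21_act_act[OF T(1) S(1)] S(2) T(2) by metis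
  moreover have "invertible (T ** S)" using S(1) T(1) by (rule invertible_mult[rotated])
  ultimately show ?thesis unfolding similar_def by blast
qed

lemma conj_hom:
  assumes "invertible T"
  shows "T ** (x ** y) ** matrix_inv T = (T ** x ** matrix_inv T) ** (T ** y ** matrix_inv T)"
    "lie_bracket (T ** x ** matrix_inv T) (T ** y ** matrix_inv T) = T ** lie_bracket x y ** matrix_inv T"
    "trace (T ** x ** matrix_inv T) = trace x" "det (T ** x ** matrix_inv T) = det x"
    "T ** x ** matrix_inv T = 0 \<longleftrightarrow> x = 0"
proof -
  show *: "T ** (x ** y) ** matrix_inv T = (T ** x ** matrix_inv T) ** (T ** y ** matrix_inv T)" for x y
    using assms by (simp add: matrix_mul_assoc matrix_inv_cancel)
  show "lie_bracket (T ** x ** matrix_inv T) (T ** y ** matrix_inv T) = T ** lie_bracket x y ** matrix_inv T"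
    unfolding lie_bracket_def matrix_diff_ldistrib matrix_diff_rdistrib * ..
  show "trace (T ** x ** matrix_inv T) = trace x"
    using assms trace_mul_sym[of "T ** x" "matrix_inv T"] by (simp add: matrix_inv_cancel)
  have "det T * det (matrix_inv T) = 1"
    using arg_cong[OF matrix_inv_mult(1)[OF assms], of det] by (simp add: det_mul)
  then show "det (T ** x ** matrix_inv T) = det x"
    by (simp add: det_mul mult.commute mult.left_commute)
  have 0: "a ** 0 ** b = 0" for a b :: cmat3 by (simp add: vec_eq_iff matrix_matrix_mult_def)
  have 1: "matrix_inv T ** (T ** x ** matrix_inv T) ** T = x"
    using assms by (simp add: matrix_mul_assoc matrix_inv_cancel)
  show "T ** x ** matrix_inv T = 0 \<longleftrightarrow> x = 0"
  proof
    assume "T ** x ** matrix_inv T = 0"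
    then show "x = 0" using 1 unfolding \<open>T ** x ** matrix_inv T = 0\<close> 0 by simp
  qed (simp add: 0)
qed

text \<open>Conjugation is an injective algebra homomorphism preserving trace and determinant. In
  order, the properties separate abelian from nonabelian entries, {\<open>V21\<close>,
  \<open>V22\<close>} from {\<open>V23\<close>, \<open>V24\<close>}, \<open>V21\<close> from
  \<open>V22\<close>, \<open>V23\<close> from \<open>V24\<close>, \<open>V25\<close> from
  \<open>V26\<close>, and the parameters of \<open>V26\<close>.\<close>

lemma similar_invariants:
  assumes "similar u v"
  shows "(\<forall>x\<in>u. \<forall>y\<in>u. lie_bracket x y = 0) = (\<forall>x\<in>v. \<forall>y\<in>v. lie_bracket x y = 0)"
    "(\<exists>x\<in>u. x \<noteq> 0 \<and> x ** x ** x = 0) = (\<exists>x\<in>v. x \<noteq> 0 \<and> x ** x ** x = 0)"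
    "(\<forall>x\<in>u. x ** x ** x = 0) = (\<forall>x\<in>v. x ** x ** x = 0)"
    "(\<forall>x\<in>u. Re (trace (x ** x)) \<le> 0) = (\<forall>x\<in>v. Re (trace (x ** x)) \<le> 0)"
    "(\<forall>x\<in>u. \<forall>y\<in>u. lie_bracket x y ** lie_bracket x y = 0) =
     (\<forall>x\<in>v. \<forall>y\<in>v. lie_bracket x y ** lie_bracket x y = 0)"
    "(\<exists>x\<in>u. \<exists>y\<in>u. y \<noteq> 0 \<and> lie_bracket x y = y \<and> det x = d) =
     (\<exists>x\<in>v. \<exists>y\<in>v. y \<noteq> 0 \<and> lie_bracket x y = y \<and> det x = d)"
proof -
  obtain T where T: "invertible T" and v: "v = (\<lambda>x. T ** x ** matrix_inv T) ` u"
    using assms unfolding similar_def SU21_act_def by blast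
  have inj: "T ** x ** matrix_inv T = T ** y ** matrix_inv T \<longleftrightarrow> x = y" for x y
    using conj_hom(5)[OF T, of "x - y"] by (simp add: matrix_diff_ldistrib matrix_diff_rdistrib)
  note [simp] = conj_hom(2-5)[OF T] conj_hom(1)[OF T, symmetric] inj
  show "(\<forall>x\<in>u. \<forall>y\<in>u. lie_bracket x y = 0) = (\<forall>x\<in>v. \<forall>y\<in>v. lie_bracket x y = 0)"
    "(\<exists>x\<in>u. x \<noteq> 0 \<and> x ** x ** x = 0) = (\<exists>x\<in>v. x \<noteq> 0 \<and> x ** x ** x = 0)"
    "(\<forall>x\<in>u. x ** x ** x = 0) = (\<forall>x\<in>v. x ** x ** x = 0)"
    "(\<forall>x\<in>u. Re (trace (x ** x)) \<le> 0) = (\<forall>x\<in>v. Re (trace (x ** x)) \<le> 0)"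
    "(\<forall>x\<in>u. \<forall>y\<in>u. lie_bracket x y ** lie_bracket x y = 0) =
     (\<forall>x\<in>v. \<forall>y\<in>v. lie_bracket x y ** lie_bracket x y = 0)"
    "(\<exists>x\<in>u. \<exists>y\<in>u. y \<noteq> 0 \<and> lie_bracket x y = y \<and> det x = d) =
     (\<exists>x\<in>v. \<exists>y\<in>v. y \<noteq> 0 \<and> lie_bracket x y = y \<and> det x = d)"
    unfolding v by simp_all
qed

section \<open>Conjugation invariants\<close>

lemma model_abelian_iff:
  "(\<forall>x\<in>model e. \<forall>y\<in>model e. lie_bracket x y = 0) \<longleftrightarrow> e \<in> {V21, V22, V23, V24}"
proof (cases e)
  case V23
  then show ?thesis by (auto simp: lie_bracket_def mat3_consts)
next
  case V25
  have "borel_mat 1 0 (of_real 0) 0 \<in> model e" "borel_mat 0 0 (of_real 1) 0 \<in> model e"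
    unfolding V25 model.simps by blast+
  moreover have "lie_bracket (borel_mat 1 0 (of_real 0) 0) (borel_mat 0 0 (of_real 1) 0) \<noteq> 0"
    by (simp add: borel_bracket borel_linear Complex_eq)
  ultimately show ?thesis using V25 by blast
next
  case (V26 \<mu>)
  have "borel_mat 1 (- 2 * \<mu> * 1) 0 0 \<in> model e" "borel_mat 0 (- 2 * \<mu> * 0) 0 1 \<in> model e"
    unfolding V26 model.simps by blast+
  moreover have "lie_bracket (borel_mat 1 (- 2 * \<mu> * 1) 0 0) (borel_mat 0 (- 2 * \<mu> * 0) 0 1) \<noteq> 0"
    by (simp add: borel_bracket borel_linear)
  ultimately show ?thesis using V26 by blast
qed (auto simp: borel_bracket borel_linear Complex_eq)

lemma diag_cube_eq_0:
  "mat3 a 0 0 0 b 0 0 0 c ** mat3 a 0 0 0 b 0 0 0 c ** mat3 a 0 0 0 b 0 0 0 c = 0 \<longleftrightarrow>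
    a = 0 \<and> b = 0 \<and> c = 0"
  by (simp add: mat3_consts)

lemma model_nilpotent_element:
  assumes "e \<in> {V21, V22}"
  shows "\<exists>x\<in>model e. x \<noteq> 0 \<and> x ** x ** x = 0"
proof
  show "borel_mat 0 0 (of_real 0) 1 \<in> model e" using assms by (auto simp: borel_linear)
qed (simp add: borel_mat_def mat3_consts Complex_eq)

lemma model_no_nilpotent_element:
  assumes "e \<in> {V23, V24}"
  shows "\<not> (\<exists>x\<in>model e. x \<noteq> 0 \<and> x ** x ** x = 0)"
proof -
  have "\<exists>a b c. x = mat3 a 0 0 0 b 0 0 0 c" if "x \<in> model e" for x
    using assms that by (auto simp: borel_mat_def Complex_eq)
  then have "x = 0" if "x \<in> model e" "x ** x ** x = 0" for x
    using that diag_cube_eq_0 mat3_consts(2) by metis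
  then show ?thesis by blast
qed

lemma model_V21_nilpotent: "\<forall>x\<in>model V21. x ** x ** x = 0"
  by (auto simp: borel_mat_def mat3_consts Complex_eq)

lemma model_V22_not_nilpotent: "\<not> (\<forall>x\<in>model V22. x ** x ** x = 0)"
proof -
  have "borel_mat 0 1 0 0 \<in> model V22" unfolding model.simps by blast
  moreover have "borel_mat 0 1 0 0 ** borel_mat 0 1 0 0 ** borel_mat 0 1 0 0 \<noteq> 0"
    by (simp add: borel_mat_def mat3_consts Complex_eq)
  ultimately show ?thesis by blast
qed

text \<open>The eigenvalues are imaginary, so their squares are not positive; a split torus element
  has nonzero real eigenvalues.\<close>

lemma model_V23_trace: "\<forall>x\<in>model V23. Re (trace (x ** x)) \<le> 0"
proof
  fix x assume "x \<in> model V23"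
  then obtain p q where x: "x = mat3 (\<i> * of_real p) 0 0 0 (\<i> * of_real q) 0 0 0 (- \<i> * (of_real p + of_real q))"
    by auto
  have "Re (trace (x ** x)) = - (p * p + q * q + (p + q) * (p + q))"
    unfolding x by (simp add: algebra_simps)
  also have "\<dots> \<le> 0" using zero_le_square[of p] zero_le_square[of q] zero_le_square[of "p + q"] by linarith
  finally show "Re (trace (x ** x)) \<le> 0" .
qed

lemma model_V24_trace: "\<not> (\<forall>x\<in>model V24. Re (trace (x ** x)) \<le> 0)"
proof -
  have "borel_mat 1 0 0 0 \<in> model V24" unfolding model.simps by blast
  moreover have "Re (trace (borel_mat 1 0 0 0 ** borel_mat 1 0 0 0)) = 2"
    by (simp add: borel_mat_def)
  ultimately show ?thesis by force
qed

text \<open>A nonzero element of the derived algebra has rank two here, while in \<open>V26\<close>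
  it is central of rank one and squares to zero.\<close>

lemma model_V25_bracket: "\<not> (\<forall>x\<in>model V25. \<forall>y\<in>model V25. lie_bracket x y ** lie_bracket x y = 0)"
proof -
  have "borel_mat 1 0 (of_real 0) 0 \<in> model V25" "borel_mat 0 0 (of_real 1) 0 \<in> model V25"
    unfolding model.simps by blast+
  moreover have br: "lie_bracket (borel_mat 1 0 (of_real 0) 0) (borel_mat 0 0 (of_real 1) 0) = borel_mat 0 0 1 0"
    by (simp add: borel_bracket Complex_eq)
  moreover have "borel_mat 0 0 1 0 ** borel_mat 0 0 1 0 \<noteq> 0"
    by (simp add: borel_mat_def mat3_consts Complex_eq)
  ultimately show ?thesis by metis
qed

lemma V26_bracket:
  "lie_bracket (borel_mat p (- 2 * \<mu> * p) 0 q) (borel_mat p' (- 2 * \<mu> * p') 0 q')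
    = borel_mat 0 0 0 (2 * (p * q' - p' * q))"
  by (simp add: borel_bracket)

lemma model_V26_bracket: "\<forall>x\<in>model (V26 \<mu>). \<forall>y\<in>model (V26 \<mu>). lie_bracket x y ** lie_bracket x y = 0"
proof -
  have "borel_mat 0 0 0 t ** borel_mat 0 0 0 t = 0" for t
    by (simp add: borel_mat_def mat3_consts Complex_eq)
  then show ?thesis unfolding model.simps using V26_bracket by auto
qed

text \<open>An element \<open>x\<close> acting as the identity on the derived algebra has eigenvalues
  \<open>1/2 - i\<mu>\<close>, \<open>2i\<mu>\<close> and \<open>-1/2 - i\<mu>\<close>.\<close>

lemma model_V26_det:
  "(\<exists>x\<in>model (V26 \<mu>). \<exists>y\<in>model (V26 \<mu>). y \<noteq> 0 \<and> lie_bracket x y = y \<and> det x = d) \<longleftrightarrow>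
    d = Complex 0 (- 2 * \<mu> * (\<mu>\<^sup>2 + 1 / 4))"
proof -
  have det: "det (borel_mat (1 / 2) (- 2 * \<mu> * (1 / 2)) 0 t) = Complex 0 (- 2 * \<mu> * (\<mu>\<^sup>2 + 1 / 4))" for t
    by (simp add: borel_mat_def complex_eq_iff power2_eq_square algebra_simps)
  show ?thesis
  proof
    assume "\<exists>x\<in>model (V26 \<mu>). \<exists>y\<in>model (V26 \<mu>). y \<noteq> 0 \<and> lie_bracket x y = y \<and> det x = d"
    then obtain x y p q p' q' where x: "x = borel_mat p (- 2 * \<mu> * p) 0 q"
      and y: "y = borel_mat p' (- 2 * \<mu> * p') 0 q'" and xy: "y \<noteq> 0" "lie_bracket x y = y" "det x = d"
      unfolding model.simps by blast
    \<comment> \<open>The bracket is central, so y is central and nonzero; as x acts on the centre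
      by 2p, this fixes p = 1/2. The remaining central coordinate of x does not affect its
      determinant.\<close>
    have "p' = 0" "2 * (p * q' - p' * q) = q'"
      using xy(2) unfolding x y V26_bracket borel_linear by auto
    moreover from this have "q' \<noteq> 0" using xy(1) unfolding y borel_linear by auto
    ultimately have "p = 1 / 2" by auto
    then show "d = Complex 0 (- 2 * \<mu> * (\<mu>\<^sup>2 + 1 / 4))" using xy(3) det unfolding x by metis
  next
    assume d: "d = Complex 0 (- 2 * \<mu> * (\<mu>\<^sup>2 + 1 / 4))"
    let ?x = "borel_mat (1 / 2) (- 2 * \<mu> * (1 / 2)) 0 0" and ?y = "borel_mat 0 (- 2 * \<mu> * 0) 0 1"
    have "?x \<in> model (V26 \<mu>)" "?y \<in> model (V26 \<mu>)" unfolding model.simps by blast+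
    moreover have "?y \<noteq> 0" by (simp add: borel_linear)
    moreover have "lie_bracket ?x ?y = ?y" unfolding V26_bracket by simp
    ultimately show "\<exists>x\<in>model (V26 \<mu>). \<exists>y\<in>model (V26 \<mu>). y \<noteq> 0 \<and> lie_bracket x y = y \<and> det x = d"
      unfolding d using det by blast
  qed
qed

text \<open>The difference factors as a - b times a cofactor that is positive after completing the
  square; hence the determinant determines the parameter.\<close>

lemma cubic_inj:
  fixes a b :: real
  assumes "a * (a\<^sup>2 + 1 / 4) = b * (b\<^sup>2 + 1 / 4)"
  shows "a = b"
proof -
  have "(a - b) * (a\<^sup>2 + a * b + b\<^sup>2 + 1 / 4) = 0"
    using assms by (simp add: field_simps power2_eq_square)
  moreover have "a\<^sup>2 + a * b + b\<^sup>2 + 1 / 4 = (a + b / 2)\<^sup>2 + 3 / 4 * b\<^sup>2 + 1 / 4"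
    by (simp add: power2_eq_square field_simps)
  moreover have "\<dots> > 0" by (intro add_nonneg_pos add_nonneg_nonneg) auto
  ultimately show ?thesis by auto
qed

lemma similar_models_eq:
  assumes "similar (model e) (model f)"
  shows "e = f"
proof -
  note inv = similar_invariants[OF assms]
  have ab: "e \<in> {V21, V22, V23, V24} \<longleftrightarrow> f \<in> {V21, V22, V23, V24}"
    using inv(1) unfolding model_abelian_iff .
  have nil: "e \<in> {V21, V22} \<Longrightarrow> f \<notin> {V23, V24}" "e \<in> {V23, V24} \<Longrightarrow> f \<notin> {V21, V22}"
    using inv(2) model_nilpotent_element model_no_nilpotent_element by metis+
  have 1: "\<not> (e = V21 \<and> f = V22)" "\<not> (e = V22 \<and> f = V21)"
    using inv(3) model_V21_nilpotent model_V22_not_nilpotent by metis+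
  have 2: "\<not> (e = V23 \<and> f = V24)" "\<not> (e = V24 \<and> f = V23)"
    using inv(4) model_V23_trace model_V24_trace by metis+
  have 3: "\<not> (e = V25 \<and> f = V26 \<mu>)" "\<not> (e = V26 \<mu> \<and> f = V25)" for \<mu>
    using inv(5) model_V25_bracket model_V26_bracket by metis+
  have 4: "\<mu> = \<nu>" if "e = V26 \<mu>" "f = V26 \<nu>" for \<mu> \<nu>
  proof (rule cubic_inj)
    have "d = Complex 0 (- 2 * \<mu> * (\<mu>\<^sup>2 + 1 / 4)) \<longleftrightarrow> d = Complex 0 (- 2 * \<nu> * (\<nu>\<^sup>2 + 1 / 4))" for d
      using inv(6)[of d] unfolding that model_V26_det .
    then have "Complex 0 (- 2 * \<mu> * (\<mu>\<^sup>2 + 1 / 4)) = Complex 0 (- 2 * \<nu> * (\<nu>\<^sup>2 + 1 / 4))" by blast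
    then show "\<mu> * (\<mu>\<^sup>2 + 1 / 4) = \<nu> * (\<nu>\<^sup>2 + 1 / 4)" by simp
  qed
  show ?thesis
  proof (cases "e \<in> {V21, V22, V23, V24}")
    case True
    then show ?thesis using ab nil 1 2 by blast
  next
    case False
    then have "f \<notin> {V21, V22, V23, V24}" using ab by blast
    then have f: "f = V25 \<or> (\<exists>\<nu>. f = V26 \<nu>)" by (cases f) auto
    have e: "e = V25 \<or> (\<exists>\<mu>. e = V26 \<mu>)" using False by (cases e) auto
    show ?thesis using e f 3 4 by blast
  qed
qed

lemma SU21_conjugate_imp_similar:
  assumes "SU21_conjugate u v"
  shows "similar u v"
proof -
  obtain g where g: "g \<in> SU21" "SU21_act g u = v"
    using assms unfolding SU21_conjugate_def by blast
  then have "invertible g" by (simp add: SU21_def invertible_det_complex)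
  with g(2) show ?thesis unfolding similar_def by blast
qed

lemma entry_similar_model: "similar (model e) (entry_algebra e)"
  unfolding similar_def using entry_properties gram_entry_frame invertible_of_gram by metis

theorem theorem6p3:
  shows "(\<forall>e. lie_subalgebra_su21 (entry_algebra e) \<and> dim (entry_algebra e) = 2)
       \<and> (\<forall>u. lie_subalgebra_su21 u \<and> dim u = 2 \<longrightarrow> (\<exists>e. SU21_conjugate u (entry_algebra e)))
       \<and> (\<forall>e f. SU21_conjugate (entry_algebra e) (entry_algebra f) \<longleftrightarrow> e = f)"
proof (intro conjI allI impI)
  show "lie_subalgebra_su21 (entry_algebra e)" "dim (entry_algebra e) = 2" for e
    using entry_properties by blast+
next
  fix u assume "lie_subalgebra_su21 u \<and> dim u = 2"
  then obtain F e where F: "gram F = frame_form e" "u = SU21_act F (model e)"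
    using subalgebra_frame by blast
  have "SU21_conjugate u (SU21_act (entry_frame e) (model e))"
    unfolding F(2)
  proof (rule isometric_frames_conjugate)
    show "conj_transpose F ** N21 ** F = conj_transpose (entry_frame e) ** N21 ** entry_frame e"
      using F(1) gram_entry_frame unfolding gram_def by metis
  qed (use F(1) gram_entry_frame invertible_of_gram in blast)+
  then show "\<exists>e. SU21_conjugate u (entry_algebra e)" using entry_properties by metis
next
  fix e f
  show "SU21_conjugate (entry_algebra e) (entry_algebra f) \<longleftrightarrow> e = f"
  proof
    assume "SU21_conjugate (entry_algebra e) (entry_algebra f)"
    then have "similar (model e) (model f)"
      using SU21_conjugate_imp_similar entry_similar_model similar_trans similar_sym by metis
    then show "e = f" by (rule similar_models_eq)
  next
    assume "e = f"
    have "mat 1 \<in> SU21" by (rule SU21_I) (simp_all add: mat3_consts)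
    then show "SU21_conjugate (entry_algebra e) (entry_algebra f)"
      unfolding SU21_conjugate_def \<open>e = f\<close> using SU21_act_one by blast
  qed
qed

end
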